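(* Consider the recommendation bandit problem with one target task described in the context. An agent with full knowledge of the source and target matrices $A$ and $B$ (in addition to the vectors $A\theta^u$, $u\in[U]$) may attain regret \[R_H\le O\left((1-\kappa)\,b\,\sqrt{UH}\,\log\left(\frac{H}{U}\right)\right).\]
   Context: There are $U$ users; each user $u\in[U]$ has a vector $\theta^u\in\mathbb{R}^n$ with $\|\theta^u\|_2\le 1$. There is a source matrix $A\in\mathbb{R}^{a\times n}$ and a single target matrix $B\in\mathbb{R}^{b\times n}$, both of full row rank. The agent is given $A\theta^u$ for every user $u$, but not $\theta^u$. The horizon is $H$. At each round $h\in[H]$ the agent observes a user $u_h\in[U]$ and a finite decision set $\mathcal{A}_h\subset\mathbb{R}^b$, chooses $x\in\mathcal{A}_h$, and observes $X_h=\langle x,B\theta^{u_h}\rangle+\eta_h$ with $\eta_h$ i.i.d. mean-zero $1$-subgaussian. Assume $\max_h\max_{x\in\mathcal{A}_h}\|x\|_2\le 1$ and $\|B\theta^u\|_2\le 1$ for all $u$. The regret is $R_H=\mathbb{E}\big[\sum_{h=1}^H\max_{x\in\mathcal{A}_h}\langle x,B\theta^{u_h}\rangle-\sum_{h=1}^H X_h\big]$. The common information is $\kappa:=\dim(\mathrm{Row}(A)\cap\mathrm{Row}(B))/b$.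
   Formalization: The bound is stated for horizons H ≥ 2U, with one absolute constant; without H/U bounded away from 1 it fails (at H = U the logarithm is 0 while the regret can be positive). *)

theory Defs
  imports "HOL-Probability.Probability"
begin

text \<open>Vectors in R^k are represented as functions nat => real, only the coordinates
  with index < k being relevant; a k x m matrix M is a function nat => nat => real
  with entries M i j for i < k, j < m.\<close>

type_synonym rvec = "nat \<Rightarrow> real"
type_synonym rmat = "nat \<Rightarrow> nat \<Rightarrow> real"

definition inner_k :: "nat \<Rightarrow> rvec \<Rightarrow> rvec \<Rightarrow> real" where
  "inner_k k x y = (\<Sum>j<k. x j * y j)"

definition norm_k :: "nat \<Rightarrow> rvec \<Rightarrow> real" where
  "norm_k k x = sqrt (\<Sum>j<k. (x j)\<^sup>2)"

definition matvec :: "rmat \<Rightarrow> nat \<Rightarrow> rvec \<Rightarrow> rvec" where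
  "matvec M m v = (\<lambda>i. \<Sum>j<m. M i j * v j)"

definition full_row_rank :: "rmat \<Rightarrow> nat \<Rightarrow> nat \<Rightarrow> bool" where
  "full_row_rank M k m \<longleftrightarrow>
     (\<forall>c::nat \<Rightarrow> real. (\<forall>j<m. (\<Sum>i<k. c i * M i j) = 0) \<longrightarrow> (\<forall>i<k. c i = 0))"

definition row_space :: "rmat \<Rightarrow> nat \<Rightarrow> nat \<Rightarrow> rvec set" where
  "row_space M k m = {w. (\<forall>j\<ge>m. w j = 0) \<and> (\<exists>c. \<forall>j<m. w j = (\<Sum>i<k. c i * M i j))}"

definition lin_indep_fam :: "nat \<Rightarrow> (nat \<Rightarrow> rvec) \<Rightarrow> bool" where
  "lin_indep_fam l v \<longleftrightarrow>
     (\<forall>c::nat \<Rightarrow> real. (\<forall>j. (\<Sum>i<l. c i * v i j) = 0) \<longrightarrow> (\<forall>i<l. c i = 0))"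

definition subspace_dim :: "rvec set \<Rightarrow> nat" where
  "subspace_dim S = (GREATEST l. \<exists>v. (\<forall>i<l. v i \<in> S) \<and> lin_indep_fam l v)"

definition common_info :: "rmat \<Rightarrow> rmat \<Rightarrow> nat \<Rightarrow> nat \<Rightarrow> nat \<Rightarrow> real" where
  "common_info A B a b n =
     real (subspace_dim (row_space A a n \<inter> row_space B b n)) / real b"

definition subgaussian1 :: "real measure \<Rightarrow> bool" where
  "subgaussian1 N \<longleftrightarrow> prob_space N \<and> sets N = sets borel \<and>
     integrable N (\<lambda>e. e) \<and> (\<integral>e. e \<partial>N) = 0 \<and>
     (\<forall>t::real. integrable N (\<lambda>e. exp (t * e)) \<and>
                 (\<integral>e. exp (t * e) \<partial>N) \<le> exp (t\<^sup>2 / 2))"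

text \<open>History: list of past rounds (user, decision set, chosen action, observation).
  A (possibly randomized) policy maps round index, history, current user and current
  decision set to a distribution over actions.\<close>
type_synonym hist = "(nat \<times> rvec set \<times> rvec \<times> real) list"
type_synonym policy = "nat \<Rightarrow> hist \<Rightarrow> nat \<Rightarrow> rvec set \<Rightarrow> rvec pmf"

text \<open>Expected value of sum over the remaining k rounds (starting at round h, given the
  history) of (1 + mean reward). The shift by 1 makes the integrand nonnegative
  (rewards lie in [-1,1]); the observation X = <x, B theta^u> + e with e ~ N fresh.\<close>
primrec exp_shifted_reward ::
  "policy \<Rightarrow> rmat \<Rightarrow> nat \<Rightarrow> nat \<Rightarrow> (nat \<Rightarrow> rvec) \<Rightarrow> (nat \<Rightarrow> nat) \<Rightarrow> (nat \<Rightarrow> rvec set)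
     \<Rightarrow> real measure \<Rightarrow> nat \<Rightarrow> nat \<Rightarrow> hist \<Rightarrow> ennreal" where
  "exp_shifted_reward \<pi> B b n \<theta> us D N 0 h hs = 0"
| "exp_shifted_reward \<pi> B b n \<theta> us D N (Suc k) h hs =
     (\<integral>\<^sup>+ x. (ennreal (1 + inner_k b x (matvec B n (\<theta> (us h))))
        + (\<integral>\<^sup>+ e. exp_shifted_reward \<pi> B b n \<theta> us D N k (Suc h)
              (hs @ [(us h, D h, x, inner_k b x (matvec B n (\<theta> (us h))) + e)]) \<partial>N))
      \<partial>measure_pmf (\<pi> h hs (us h) (D h)))"

definition regret ::
  "policy \<Rightarrow> rmat \<Rightarrow> nat \<Rightarrow> nat \<Rightarrow> (nat \<Rightarrow> rvec) \<Rightarrow> (nat \<Rightarrow> nat) \<Rightarrow> (nat \<Rightarrow> rvec set)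
     \<Rightarrow> real measure \<Rightarrow> nat \<Rightarrow> real" where
  "regret \<pi> B b n \<theta> us D N H =
     (\<Sum>h<H. Max ((\<lambda>x. inner_k b x (matvec B n (\<theta> (us h)))) ` D h))
     - (enn2real (exp_shifted_reward \<pi> B b n \<theta> us D N H 0 []) - real H)"

end

theory Submission
  imports Defs
begin

text \<open>
  Split $R^b$ into the directions whose rewards are determined by $A\theta^u$ and their
  orthogonal complement, which has dimension at most $d = (1-\kappa) b$. Each user is served by
  ridge regression on the $d$ unknown coordinates, playing the action that maximises
  estimate plus $\frac{1}{2}\gamma \|\phi(x)\|^2_{M^{-1}}$, where $\gamma$ is the square root of
  the user's round number. The \<^emph>\<open>quadratic\<close> bonus makes high-probability
  confidence sets unnecessary: by Young's inequality the regret of a round is at most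
  $\gamma \|\phi\|^2_{M^{-1}} + Q / \gamma$, where $Q$ is the squared estimation error in the norm
  of $M$, and the least squares recursion shows that $Q - 3 \log\det M$ is a supermartingale.
  With $\log\det M \le d \log(1+T)$ this gives expected regret $O(d \sqrt{T} \log (1+T))$ for a
  user with $T$ rounds.
\<close>

section \<open>Inner products of coordinate vectors\<close>

lemma inner_k_add_scale_right:
  "inner_k d x (\<lambda>i. y i + c * z i) = inner_k d x y + c * inner_k d x z"
  by (simp add: inner_k_def sum.distrib sum_distrib_left algebra_simps)

lemma inner_k_add_scale_left:
  "inner_k d (\<lambda>i. y i + c * z i) x = inner_k d y x + c * inner_k d z x"
  by (simp add: inner_k_def sum.distrib sum_distrib_left algebra_simps)

lemma inner_k_commute: "inner_k d x y = inner_k d y x"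
  by (simp add: inner_k_def mult.commute)

lemma inner_k_self_nonneg: "0 \<le> inner_k d x x"
  by (simp add: inner_k_def sum_nonneg)

lemma inner_k_self_eq_0: "inner_k d x x = 0 \<Longrightarrow> i < d \<Longrightarrow> x i = 0"
  by (simp add: inner_k_def sum_nonneg_eq_0_iff)

lemma inner_k_cong:
  "(\<And>i. i < d \<Longrightarrow> x i = x' i) \<Longrightarrow> (\<And>i. i < d \<Longrightarrow> y i = y' i) \<Longrightarrow> inner_k d x y = inner_k d x' y'"
  by (simp add: inner_k_def)

lemma inner_k_sum_left:
  "inner_k d (\<lambda>i. \<Sum>j\<in>J. c j * v j i) x = (\<Sum>j\<in>J. c j * inner_k d (v j) x)"
proof -
  have "inner_k d (\<lambda>i. \<Sum>j\<in>J. c j * v j i) x = (\<Sum>i<d. \<Sum>j\<in>J. c j * (v j i * x i))"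
    by (simp add: inner_k_def sum_distrib_right mult.assoc)
  also have "\<dots> = (\<Sum>j\<in>J. \<Sum>i<d. c j * (v j i * x i))" by (rule sum.swap)
  finally show ?thesis by (simp add: inner_k_def sum_distrib_left)
qed

lemma norm_k_le_1_iff: "norm_k k x \<le> 1 \<longleftrightarrow> inner_k k x x \<le> 1"
  by (simp add: norm_k_def inner_k_def power2_eq_square)

lemma abs_inner_k_le_1:
  assumes "inner_k k x x \<le> 1" "inner_k k y y \<le> 1"
  shows "\<bar>inner_k k x y\<bar> \<le> 1"
proof -
  have "0 \<le> inner_k k (\<lambda>i. x i + 1 * y i) (\<lambda>i. x i + 1 * y i)"
    "0 \<le> inner_k k (\<lambda>i. x i + (-1) * y i) (\<lambda>i. x i + (-1) * y i)"
    by (rule inner_k_self_nonneg)+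
  then show ?thesis using assms
    unfolding inner_k_add_scale_left inner_k_add_scale_right
    using inner_k_commute[of k x y] by simp
qed


section \<open>Regularised least squares\<close>

text \<open>The bilinear form x^T M y of the regularised design matrix M, the identity plus the sum
  of all p p^T.\<close>

primrec design_form :: "nat \<Rightarrow> rvec list \<Rightarrow> rvec \<Rightarrow> rvec \<Rightarrow> real" where
  "design_form d [] x y = inner_k d x y"
| "design_form d (p # ps) x y = design_form d ps x y + inner_k d p x * inner_k d p y"

text \<open>The Sherman--Morrison formula, so that \<open>design_inv d ps\<close> inverts
  $I + \sum_{p} p p^T$ without any matrix being inverted.\<close>

primrec design_inv :: "nat \<Rightarrow> rvec list \<Rightarrow> rvec \<Rightarrow> rvec" where
  "design_inv d [] x = x"
| "design_inv d (p # ps) x = (\<lambda>i. design_inv d ps x i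
      + (- inner_k d p (design_inv d ps x) / (1 + inner_k d p (design_inv d ps p)))
        * design_inv d ps p i)"

text \<open>This is x^T M^{-1} y, the posterior covariance in a Gaussian linear model with unit
  prior and noise.\<close>

definition cov :: "nat \<Rightarrow> rvec list \<Rightarrow> rvec \<Rightarrow> rvec \<Rightarrow> real" where
  "cov d ps x y = inner_k d x (design_inv d ps y)"

text \<open>The logarithm of det M, accumulated by the matrix determinant lemma det (M + p p^T) =
  det M (1 + p^T M^{-1} p).\<close>

primrec log_det :: "nat \<Rightarrow> rvec list \<Rightarrow> real" where
  "log_det d [] = 0"
| "log_det d (p # ps) = log_det d ps + ln (1 + cov d ps p p)"

lemma design_form_add_scale_left:
  "design_form d ps (\<lambda>i. y i + c * z i) x = design_form d ps y x + c * design_form d ps z x"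
  by (induction ps) (simp_all add: inner_k_add_scale_left inner_k_add_scale_right algebra_simps)

lemma design_form_commute: "design_form d ps x y = design_form d ps y x"
  by (induction ps) (simp_all add: inner_k_commute mult.commute)

lemma design_form_add_scale_right:
  "design_form d ps x (\<lambda>i. y i + c * z i) = design_form d ps x y + c * design_form d ps x z"
  by (metis design_form_add_scale_left design_form_commute)

lemma design_form_self_nonneg: "0 \<le> design_form d ps x x"
  by (induction ps) (simp_all add: inner_k_self_nonneg)

text \<open>Certifies \<open>design_inv\<close> as the inverse of M. The induction hypothesis writes
  s = p^T M^{-1} p as a value of the positive form, so 1 + s is a legitimate divisor.\<close>

lemma design_form_inv: "design_form d ps (design_inv d ps x) y = inner_k d x y"
proof (induction ps arbitrary: x y)
  case (Cons p ps)
  define g where "g = inner_k d p (design_inv d ps x)"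
  define s where "s = inner_k d p (design_inv d ps p)"
  have "s = design_form d ps (design_inv d ps p) (design_inv d ps p)"
    by (simp add: s_def Cons.IH)
  then have "1 + s > 0" using design_form_self_nonneg[of d ps "design_inv d ps p"] by simp
  then have c: "g + - g / (1 + s) * s = g / (1 + s)" by (simp add: field_simps)
  have "design_form d (p # ps) (design_inv d (p # ps) x) y
      = inner_k d x y + - g / (1 + s) * inner_k d p y + (g + - g / (1 + s) * s) * inner_k d p y"
    by (simp only: design_form.simps design_inv.simps design_form_add_scale_left
        inner_k_add_scale_right Cons.IH flip: g_def s_def) (simp only: algebra_simps)
  also have "\<dots> = inner_k d x y" unfolding c by (simp add: field_simps)
  finally show ?case .
qed simp

lemma cov_eq_design_form: "cov d ps x y = design_form d ps (design_inv d ps x) (design_inv d ps y)"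
  by (simp add: cov_def design_form_inv)

lemma cov_self_nonneg: "0 \<le> cov d ps x x"
  by (simp add: cov_eq_design_form design_form_self_nonneg)

lemma cov_commute: "cov d ps x y = cov d ps y x"
  by (metis cov_eq_design_form design_form_commute)

lemma cov_Nil [simp]: "cov d [] x y = inner_k d x y"
  by (simp add: cov_def)

lemma cov_Cons: "cov d (p # ps) x y = cov d ps x y - cov d ps x p * cov d ps p y / (1 + cov d ps p p)"
  unfolding cov_def design_inv.simps inner_k_add_scale_right by simp

text \<open>The rank-one correction is a square over a positive number, so observations only shrink
  the variance.\<close>

lemma cov_self_le: "cov d ps x x \<le> inner_k d x x"
proof (induction ps)
  case (Cons p ps)
  have "0 \<le> cov d ps x p * cov d ps p x / (1 + cov d ps p p)"
    using cov_self_nonneg[of d ps p] cov_commute[of d ps p x] by simp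
  then show ?case using Cons by (simp add: cov_Cons)
qed simp

text \<open>Completing the square: the form is nonnegative at e - c M^{-1} x. This trades a
  prediction error for a bonus and a loss.\<close>

lemma design_form_young:
  "2 * c * inner_k d x e \<le> c\<^sup>2 * cov d ps x x + design_form d ps e e"
proof -
  define g where "g = design_inv d ps x"
  have "0 \<le> design_form d ps (\<lambda>i. e i + (- c) * g i) (\<lambda>i. e i + (- c) * g i)"
    by (rule design_form_self_nonneg)
  also have "\<dots> = design_form d ps e e - 2 * c * inner_k d x e + c\<^sup>2 * cov d ps x x"
    unfolding design_form_add_scale_left design_form_add_scale_right
    using design_form_inv[of d ps x e] design_form_commute[of d ps e g]
    by (simp add: g_def cov_eq_design_form algebra_simps power2_eq_square)
  finally show ?thesis by simp
qed

lemma design_form_unit_le: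
  assumes "\<forall>p\<in>set ps. inner_k d p p \<le> 1" "inner_k d e e \<le> 1"
  shows "design_form d ps e e \<le> 1 + real (length ps)"
  using assms(1)
proof (induction ps)
  case (Cons p ps)
  have "(inner_k d p e)\<^sup>2 \<le> 1"
    using abs_inner_k_le_1[of d p e] Cons.prems assms(2) by (simp add: abs_square_le_1)
  then show ?case using Cons by (simp add: power2_eq_square)
qed (use assms in simp)

definition unit_vec :: "nat \<Rightarrow> rvec" where
  "unit_vec j = (\<lambda>i. if i = j then 1 else 0)"

lemma inner_k_unit_vec: "j < d \<Longrightarrow> inner_k d x (unit_vec j) = x j"
  by (simp add: inner_k_def unit_vec_def if_distrib sum.delta cong: if_cong)

lemma cov_unit_vec_pos: "j < d \<Longrightarrow> 0 < cov d ps (unit_vec j) (unit_vec j)"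
proof (rule ccontr)
  assume j: "j < d" and "\<not> 0 < cov d ps (unit_vec j) (unit_vec j)"
  then have z: "cov d ps (unit_vec j) (unit_vec j) = 0"
    using cov_self_nonneg[of d ps "unit_vec j"] by simp
  have "inner_k d (unit_vec j) (unit_vec j) = 1"
    using inner_k_unit_vec[OF j] by (simp add: unit_vec_def)
  \<comment> \<open>With zero variance, Young's inequality would bound 2 c by a fixed number for
    every c; this c violates it.\<close>
  then show False
    using design_form_young[of "design_form d ps (unit_vec j) (unit_vec j) / 2 + 1" d
        "unit_vec j" "unit_vec j" ps] z by simp
qed

text \<open>Young's inequality at its best c, the reciprocal of the j-th diagonal entry of M^{-1},
  bounds this reciprocal by the j-th diagonal entry of M.\<close>

lemma cov_unit_vec_ge:
  assumes "j < d" "\<forall>p\<in>set ps. inner_k d p p \<le> 1"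
  shows "1 / cov d ps (unit_vec j) (unit_vec j) \<le> 1 + real (length ps)"
proof -
  let ?k = "cov d ps (unit_vec j) (unit_vec j)"
  have k: "?k > 0" using cov_unit_vec_pos assms by simp
  have e: "inner_k d (unit_vec j) (unit_vec j) = 1"
    using inner_k_unit_vec assms(1) by (simp add: unit_vec_def)
  have "2 * (1 / ?k) \<le> (1 / ?k)\<^sup>2 * ?k + design_form d ps (unit_vec j) (unit_vec j)"
    using design_form_young[of "1 / ?k" d "unit_vec j" "unit_vec j" ps] e by simp
  also have "(1 / ?k)\<^sup>2 * ?k = 1 / ?k" using k by (simp add: power2_eq_square)
  finally show ?thesis using design_form_unit_le[OF assms(2), of "unit_vec j"] e by simp
qed

text \<open>Both sides are the Schur complement of the pivot block with rows (P, c) and (c, 1 + s),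
  eliminated in the two possible orders; \<open>D\<close> is the determinant of that block.\<close>

lemma conditioning_commutes:
  fixes P s c :: real
  assumes "P > 0" "1 + s > 0" "P * (1 + s) - c\<^sup>2 > 0"
  shows "(m - f * g / P) - (a - f * c / P) * (b - c * g / P) / (1 + (s - c * c / P))
    = (m - a * b / (1 + s)) - (f - a * c / (1 + s)) * (g - c * b / (1 + s)) / (P - c * c / (1 + s))"
proof -
  define D where "D = P * (1 + s) - c\<^sup>2"
  have D: "D > 0" using assms by (simp add: D_def)
  have "1 + (s - c * c / P) = D / P" "P - c * c / (1 + s) = D / (1 + s)"
    "a - f * c / P = (a * P - f * c) / P" "b - c * g / P = (b * P - c * g) / P"
    "f - a * c / (1 + s) = (f * (1 + s) - a * c) / (1 + s)"
    "g - c * b / (1 + s) = (g * (1 + s) - c * b) / (1 + s)"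
    using assms by (simp_all add: D_def field_simps power2_eq_square)
  then have l: "(m - f * g / P) - (a - f * c / P) * (b - c * g / P) / (1 + (s - c * c / P))
      = m - (f * g * D + (a * P - f * c) * (b * P - c * g)) / (P * D)"
    and r: "(m - a * b / (1 + s)) - (f - a * c / (1 + s)) * (g - c * b / (1 + s)) / (P - c * c / (1 + s))
      = m - (a * b * D + (f * (1 + s) - a * c) * (g * (1 + s) - c * b)) / ((1 + s) * D)"
    using assms D by (simp_all add: divide_simps) (simp_all add: algebra_simps)
  have "(f * g * D + (a * P - f * c) * (b * P - c * g)) * (1 + s)
      = (a * b * D + (f * (1 + s) - a * c) * (g * (1 + s) - c * b)) * P"
    unfolding D_def by (simp add: algebra_simps power2_eq_square)
  then have "(f * g * D + (a * P - f * c) * (b * P - c * g)) / (P * D)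
      = (a * b * D + (f * (1 + s) - a * c) * (g * (1 + s) - c * b)) / ((1 + s) * D)"
    using assms D by (simp add: frac_eq_eq mult_ac)
  then show ?thesis unfolding l r by simp
qed

text \<open>The design matrix in dimension d is the leading principal block of the one in dimension
  d + 1, so its inverse is a Schur complement: the covariance conditioned on the last coordinate.
  Conditioning commutes with observing \<open>p\<close>.\<close>

lemma cov_condition:
  "cov d ps x y = cov (Suc d) ps x y
     - cov (Suc d) ps x (unit_vec d) * cov (Suc d) ps (unit_vec d) y
       / cov (Suc d) ps (unit_vec d) (unit_vec d)"
proof (induction ps arbitrary: x y)
  case Nil
  have "inner_k (Suc d) (unit_vec d) z = z d" for z
    using inner_k_unit_vec[of d "Suc d" z] by (simp add: inner_k_commute)
  then show ?case by (simp add: inner_k_unit_vec) (simp add: inner_k_def unit_vec_def)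
next
  case (Cons p ps)
  let ?e = "unit_vec d" and ?k = "cov (Suc d) ps"
  have P: "?k ?e ?e > 0" by (rule cov_unit_vec_pos) simp
  have s: "1 + ?k p p > 0" using cov_self_nonneg[of "Suc d" ps p] by simp
  have D: "?k ?e ?e * (1 + ?k p p) - (?k p ?e)\<^sup>2 > 0"
  proof -
    have "0 < cov (Suc d) (p # ps) ?e ?e" by (rule cov_unit_vec_pos) simp
    then show ?thesis
      using s by (simp add: cov_Cons field_simps power2_eq_square cov_commute[of _ _ ?e p])
  qed
  have "cov d (p # ps) x y = (?k x y - ?k x ?e * ?k ?e y / ?k ?e ?e)
      - (?k x p - ?k x ?e * ?k p ?e / ?k ?e ?e) * (?k p y - ?k p ?e * ?k ?e y / ?k ?e ?e)
        / (1 + (?k p p - ?k p ?e * ?k p ?e / ?k ?e ?e))"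
    using cov_commute[of "Suc d" ps ?e p] by (simp add: cov_Cons Cons.IH)
  also have "\<dots> = (?k x y - ?k x p * ?k p y / (1 + ?k p p))
      - (?k x ?e - ?k x p * ?k p ?e / (1 + ?k p p)) * (?k ?e y - ?k p ?e * ?k p y / (1 + ?k p p))
        / (?k ?e ?e - ?k p ?e * ?k p ?e / (1 + ?k p p))"
    by (rule conditioning_commutes[OF P s D])
  finally show ?case using cov_commute[of "Suc d" ps ?e p] by (simp add: cov_Cons)
qed

text \<open>Cramer's rule: the last diagonal entry of the inverse in dimension d + 1 is the quotient
  of the two determinants.\<close>

lemma log_det_Suc:
  "log_det (Suc d) ps = log_det d ps - ln (cov (Suc d) ps (unit_vec d) (unit_vec d))"
proof (induction ps)
  case Nil
  then show ?case using inner_k_unit_vec[of d "Suc d" "unit_vec d"] by (simp add: unit_vec_def)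
next
  case (Cons p ps)
  let ?e = "unit_vec d" and ?k = "cov (Suc d) ps"
  have P: "?k ?e ?e > 0" by (rule cov_unit_vec_pos) simp
  have P': "cov (Suc d) (p # ps) ?e ?e > 0" by (rule cov_unit_vec_pos) simp
  have s: "1 + ?k p p > 0" using cov_self_nonneg[of "Suc d" ps p] by simp
  have s': "1 + cov d ps p p > 0" using cov_self_nonneg[of d ps p] by simp
  \<comment> \<open>Both products equal the determinant of the pivot block in
    \<open>conditioning_commutes\<close>.\<close>
  have "cov (Suc d) (p # ps) ?e ?e * (1 + ?k p p) = ?k ?e ?e * (1 + cov d ps p p)"
    using s P by (simp add: cov_Cons cov_condition[of d ps p p] field_simps
        cov_commute[of "Suc d" ps ?e p])
  then have "ln (cov (Suc d) (p # ps) ?e ?e) + ln (1 + ?k p p)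
      = ln (?k ?e ?e) + ln (1 + cov d ps p p)"
    using P P' s s' by (metis ln_mult_pos)
  then show ?case using Cons by simp
qed

lemma inner_k_le_Suc: "inner_k d x x \<le> inner_k (Suc d) x x"
  by (simp add: inner_k_def)

text \<open>Induction on the dimension: each new coordinate contributes minus the logarithm of a
  diagonal entry of the inverse, which \<open>cov_unit_vec_ge\<close> bounds.\<close>

lemma log_det_le:
  assumes "\<forall>p\<in>set ps. inner_k d p p \<le> 1"
  shows "log_det d ps \<le> real d * ln (1 + real (length ps))"
  using assms
proof (induction d)
  case 0
  have "log_det 0 ps = 0" by (induction ps) (simp_all add: cov_def inner_k_def)
  then show ?case by simp
next
  case (Suc d)
  let ?v = "cov (Suc d) ps (unit_vec d) (unit_vec d)"
  have v: "?v > 0" by (rule cov_unit_vec_pos) simp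
  have "ln (1 / ?v) \<le> ln (1 + real (length ps))"
    using cov_unit_vec_ge[of d "Suc d" ps] Suc.prems v by (subst ln_le_cancel_iff) auto
  then have "- ln ?v \<le> ln (1 + real (length ps))" using v by (simp add: ln_div)
  moreover have "log_det d ps \<le> real d * ln (1 + real (length ps))"
    using Suc inner_k_le_Suc order_trans by blast
  ultimately show ?case by (simp add: log_det_Suc algebra_simps)
qed

section \<open>Recursive ridge regression and its error\<close>

text \<open>Recursive least squares, newest sample first: the prediction residual is multiplied by
  the gain M^{-1} p / (1 + s), which is the updated inverse applied to p.\<close>

primrec ridge :: "nat \<Rightarrow> (rvec \<times> real) list \<Rightarrow> rvec" where
  "ridge d [] = (\<lambda>i. 0)"
| "ridge d (z # zs) = (\<lambda>i. ridge d zs i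
      + (snd z - inner_k d (fst z) (ridge d zs)) / (1 + cov d (map fst zs) (fst z) (fst z))
        * design_inv d (map fst zs) (fst z) i)"

definition ridge_error :: "nat \<Rightarrow> rvec \<Rightarrow> (rvec \<times> real) list \<Rightarrow> rvec" where
  "ridge_error d w zs = (\<lambda>i. w i + (- 1) * ridge d zs i)"

definition ridge_loss :: "nat \<Rightarrow> rvec \<Rightarrow> (rvec \<times> real) list \<Rightarrow> real" where
  "ridge_loss d w zs = design_form d (map fst zs) (ridge_error d w zs) (ridge_error d w zs)"

lemma ridge_loss_nonneg: "0 \<le> ridge_loss d w zs"
  by (simp add: ridge_loss_def design_form_self_nonneg)

lemma ridge_loss_Nil: "ridge_loss d w [] = inner_k d w w"
  by (simp add: ridge_loss_def ridge_error_def)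

text \<open>The error moves by - c M^{-1} p with c = (z + \<eta>) / (1 + s), and the new form adds
  the squared inner product of \<open>p\<close> with the new error. The result is quadratic in the
  noise, so two moments determine its mean.\<close>

lemma ridge_loss_Cons:
  fixes p w :: rvec and d :: nat and zs :: "(rvec \<times> real) list"
  defines "z \<equiv> inner_k d p (ridge_error d w zs)" and "s \<equiv> cov d (map fst zs) p p"
  shows "ridge_loss d w ((p, inner_k d p w + \<eta>) # zs)
    = ridge_loss d w zs - z\<^sup>2 - 2 * z * \<eta> + (z + \<eta>)\<^sup>2 * (s / (1 + s))"
proof -
  define e g where "e = ridge_error d w zs" and "g = design_inv d (map fst zs) p"
  define c where "c = (z + \<eta>) / (1 + s)"
  have s: "1 + s > 0" using cov_self_nonneg[of d "map fst zs" p] by (simp add: s_def)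
  have z: "z = inner_k d p w - inner_k d p (ridge d zs)"
    unfolding z_def ridge_error_def inner_k_add_scale_right by simp
  have c: "(inner_k d p w + \<eta> - inner_k d p (ridge d zs)) / (1 + cov d (map fst zs) p p) = c"
    by (simp add: c_def z s_def)
  have e': "ridge_error d w ((p, inner_k d p w + \<eta>) # zs) = (\<lambda>i. e i + (- c) * g i)"
    unfolding ridge_error_def ridge.simps fst_conv snd_conv c
    by (simp add: e_def g_def ridge_error_def algebra_simps)
  have eg: "design_form d (map fst zs) g e = z" "design_form d (map fst zs) e g = z"
    using design_form_inv[of d "map fst zs" p e] design_form_commute[of d _ e g]
    by (simp_all add: g_def z_def e_def)
  have gg: "design_form d (map fst zs) g g = s" "inner_k d p g = s"
    by (simp_all add: g_def s_def cov_def design_form_inv)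
  have "ridge_loss d w ((p, inner_k d p w + \<eta>) # zs)
      = (ridge_loss d w zs - 2 * c * z + c\<^sup>2 * s) + (z - c * s)\<^sup>2"
    unfolding ridge_loss_def e' list.map fst_conv design_form.simps
      design_form_add_scale_left design_form_add_scale_right inner_k_add_scale_right eg gg
    by (simp add: e_def z_def algebra_simps power2_eq_square)
  also have "\<dots> = ridge_loss d w zs - z\<^sup>2 - 2 * z * \<eta> + (z + \<eta>)\<^sup>2 * (s / (1 + s))"
  proof -
    have h: "\<eta> = c * (1 + s) - z" using s by (simp add: c_def)
    have r: "(z + \<eta>)\<^sup>2 * (s / (1 + s)) = c\<^sup>2 * (1 + s) * s"
      using s unfolding h by (simp add: power2_eq_square)
    show ?thesis unfolding r by (simp add: h algebra_simps power2_eq_square)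
  qed
  finally show ?thesis .
qed

text \<open>The square is dominated by exponentials at 1 and -1, whose means are controlled. The
  resulting 4 (e^{1/2} - 1) is at most 3, which is the factor of the log-determinant in
  \<open>regret_potential\<close>.\<close>

lemma subgaussian1_second_moment:
  assumes "subgaussian1 N"
  shows "integrable N (\<lambda>e. e\<^sup>2)" "(\<integral>e. e\<^sup>2 \<partial>N) \<le> 3"
proof -
  have sets: "sets N = sets borel" and "prob_space N"
    and i: "integrable N (\<lambda>e. exp (t * e))" and m: "(\<integral>e. exp (t * e) \<partial>N) \<le> exp (t\<^sup>2 / 2)" for t
    using assms by (auto simp: subgaussian1_def)
  interpret prob_space N by fact
  have b: "x\<^sup>2 \<le> 2 * (exp (1 * x) + exp (- 1 * x) - 2)" for x :: real
  proof -
    \<comment> \<open>Adds e^x \<ge> 1 + x + x^2 / 2 and e^{-x} \<ge> 1 - x.\<close>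
    have *: "x\<^sup>2 \<le> 2 * (exp x + exp (- x) - 2)" if "x \<ge> 0" for x :: real
      using exp_lower_Taylor_quadratic[OF that] exp_ge_add_one_self[of "- x"] by simp
    show ?thesis using *[of x] *[of "- x"] by (cases "x \<ge> 0") auto
  qed
  have i2: "integrable N (\<lambda>x. 2 * (exp (1 * x) + exp (- 1 * x) - 2))"
    using i[of 1] i[of "- 1"] by simp
  have b': "norm (x\<^sup>2) \<le> norm (2 * (exp (1 * x) + exp (- 1 * x) - 2))" for x :: real
    unfolding real_norm_def
    using b[of x] abs_ge_self[of "2 * (exp (1 * x) + exp (- 1 * x) - 2)"] zero_le_power2[of x]
    by linarith
  have "(\<lambda>x::real. x\<^sup>2) \<in> borel_measurable N"
    using sets by (simp add: measurable_cong_sets[OF sets refl])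
  then show sq: "integrable N (\<lambda>e. e\<^sup>2)"
    by (rule Bochner_Integration.integrable_bound[OF i2]) (intro AE_I2 b')
  have "(\<integral>e. e\<^sup>2 \<partial>N) \<le> (\<integral>x. 2 * (exp (1 * x) + exp (- 1 * x) - 2) \<partial>N)"
    using b by (intro integral_mono sq i2)
  also have "\<dots> = 2 * ((\<integral>x. exp (1 * x) \<partial>N) + (\<integral>x. exp (- 1 * x) \<partial>N) - 2)"
    using i[of 1] i[of "- 1"] by (simp add: prob_space)
  also have "\<dots> \<le> 4 * (exp (1 / 2) - 1)" using m[of 1] m[of "- 1"] by simp
  also have "\<dots> \<le> 3" using exp_bound[of "1 / 2"] by (simp add: power2_eq_square)
  finally show "(\<integral>e. e\<^sup>2 \<partial>N) \<le> 3" .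
qed

section \<open>The regret potential of one user\<close>

lemma ln_one_plus_ge:
  fixes s :: real
  assumes "s \<ge> 0"
  shows "s / (1 + s) \<le> ln (1 + s)"
proof -
  have "ln (1 / (1 + s)) \<le> 1 / (1 + s) - 1" using assms by (intro ln_le_minus_one) simp
  then show ?thesis using assms by (simp add: ln_div field_simps)
qed

text \<open>A budget for the expected regret in the remaining rounds of a user with T rounds in all.
  The first summand pays the bonuses out of the log-determinant growth still possible. In the
  second, the first factor bounds the expected loss in any later round, and 2 (sqrt T - sqrt t),
  with t samples seen, bounds the remaining sum of 1 / \<gamma>.\<close>

definition regret_potential :: "nat \<Rightarrow> nat \<Rightarrow> rvec \<Rightarrow> (rvec \<times> real) list \<Rightarrow> real" where
  "regret_potential d T w zs =
     2 * sqrt T * (d * ln (1 + real T) - log_det d (map fst zs))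
     + (ridge_loss d w zs - 3 * log_det d (map fst zs) + 3 * (d * ln (1 + real T)))
       * (2 * (sqrt T - sqrt (length zs)))"

lemma log_det_le_horizon:
  assumes "\<forall>z\<in>set zs. inner_k d (fst z) (fst z) \<le> 1" "length zs \<le> T"
  shows "log_det d (map fst zs) \<le> d * ln (1 + real T)"
proof -
  have "log_det d (map fst zs) \<le> d * ln (1 + real (length zs))"
    using log_det_le[of "map fst zs" d] assms(1) by simp
  also have "\<dots> \<le> d * ln (1 + real T)" using assms(2) by (intro mult_left_mono) auto
  finally show ?thesis .
qed

lemma regret_potential_nonneg:
  assumes "\<forall>z\<in>set zs. inner_k d (fst z) (fst z) \<le> 1" "length zs \<le> T"
  shows "0 \<le> regret_potential d T w zs"
  unfolding regret_potential_def
  using log_det_le_horizon[OF assms] ridge_loss_nonneg[of d w zs] assms(2) by simp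

text \<open>The expected drop covers the regret bound of \<open>optimistic_score_regret\<close>: the
  bonus because s \<le> 2 ln (1 + s), the loss because Q minus three log-determinants is a
  supermartingale and 1 / \<gamma> is at most the drop of the square root factor.\<close>

lemma regret_potential_Cons:
  assumes N: "subgaussian1 N"
    and zs: "\<forall>z\<in>set zs. inner_k d (fst z) (fst z) \<le> 1" "Suc (length zs) \<le> T"
    and p: "inner_k d p p \<le> 1"
  shows "integrable N (\<lambda>\<eta>. regret_potential d T w ((p, inner_k d p w + \<eta>) # zs))" (is ?I)
    and "(\<integral>\<eta>. regret_potential d T w ((p, inner_k d p w + \<eta>) # zs) \<partial>N)
      \<le> regret_potential d T w zs - sqrt (1 + real (length zs)) * cov d (map fst zs) p p
        - ridge_loss d w zs / sqrt (1 + real (length zs))" (is ?L)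
proof -
  interpret prob_space N using N by (simp add: subgaussian1_def)
  have i1: "integrable N (\<lambda>e. e)" and m1: "(\<integral>e. e \<partial>N) = 0" using N by (auto simp: subgaussian1_def)
  note sq = subgaussian1_second_moment[OF N]
  define s q z Q where "s = cov d (map fst zs) p p" and "q = s / (1 + s)"
    and "z = inner_k d p (ridge_error d w zs)" and "Q = ridge_loss d w zs"
  define l L \<rho> \<gamma> where "l = d * ln (1 + real T)" and "L = log_det d (map fst zs)"
    and "\<rho> = sqrt T - sqrt (1 + real (length zs))" and "\<gamma> = sqrt (1 + real (length zs))"
  have s: "0 \<le> s" "s \<le> 1"
    using cov_self_nonneg cov_self_le[of d "map fst zs" p] p by (auto simp: s_def)
  have q: "0 \<le> q" "q \<le> 1" "q \<le> ln (1 + s)" "s / 2 \<le> q"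
  proof -
    show "0 \<le> q" "q \<le> 1" "q \<le> ln (1 + s)" using s ln_one_plus_ge[of s] by (auto simp: q_def)
    \<comment> \<open>The unit bound on the feature enters through s \<le> 1; with q \<le> ln (1 +
      s) this gives s \<le> 2 ln (1 + s).\<close>
    have "s * (1 + s) \<le> s * 2" using s by (intro mult_left_mono) auto
    then show "s / 2 \<le> q" using s by (simp add: q_def field_simps)
  qed
  have rho: "\<rho> \<ge> 0" using zs(2) by (simp add: \<rho>_def)
  have loss: "ridge_loss d w ((p, inner_k d p w + \<eta>) # zs)
      = (Q - z\<^sup>2 + z\<^sup>2 * q) + (2 * z * q - 2 * z) * \<eta> + q * \<eta>\<^sup>2" for \<eta>
    unfolding ridge_loss_Cons s_def[symmetric] z_def[symmetric] Q_def[symmetric] q_def[symmetric]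
    by (simp add: algebra_simps power2_eq_square)
  have il: "integrable N (\<lambda>\<eta>. ridge_loss d w ((p, inner_k d p w + \<eta>) # zs))"
    unfolding loss using i1 sq(1) by simp
  \<comment> \<open>The term linear in the noise has mean zero; the nonpositive z^2 (q - 1) is
    dropped in the next step.\<close>
  have "(\<integral>\<eta>. ridge_loss d w ((p, inner_k d p w + \<eta>) # zs) \<partial>N)
      = (Q - z\<^sup>2 + z\<^sup>2 * q) + q * (\<integral>\<eta>. \<eta>\<^sup>2 \<partial>N)"
    unfolding loss using i1 sq(1) by (simp add: m1 prob_space)
  also have "\<dots> \<le> Q + q * 3"
    using mult_left_mono[OF sq(2) q(1)] mult_left_mono[OF q(2), of "z\<^sup>2"] by simp
  finally have ml: "(\<integral>\<eta>. ridge_loss d w ((p, inner_k d p w + \<eta>) # zs) \<partial>N) \<le> Q + 3 * ln (1 + s)"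
    using q(3) by linarith
  have pot: "regret_potential d T w ((p, inner_k d p w + \<eta>) # zs)
      = 2 * sqrt T * (l - L - ln (1 + s))
        + (ridge_loss d w ((p, inner_k d p w + \<eta>) # zs) - 3 * (L + ln (1 + s)) + 3 * l) * (2 * \<rho>)" for \<eta>
    by (simp add: regret_potential_def l_def L_def \<rho>_def s_def algebra_simps)
  show ?I unfolding pot using il by simp
  have "(\<integral>\<eta>. regret_potential d T w ((p, inner_k d p w + \<eta>) # zs) \<partial>N)
      = 2 * sqrt T * (l - L - ln (1 + s))
        + ((\<integral>\<eta>. ridge_loss d w ((p, inner_k d p w + \<eta>) # zs) \<partial>N) - 3 * (L + ln (1 + s)) + 3 * l) * (2 * \<rho>)"
    unfolding pot using il by (simp add: prob_space)
  also have "\<dots> \<le> 2 * sqrt T * (l - L - ln (1 + s)) + (Q - 3 * L + 3 * l) * (2 * \<rho>)"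
    using ml rho by (intro add_left_mono mult_right_mono) auto
  also have "\<dots> \<le> regret_potential d T w zs - \<gamma> * s - Q / \<gamma>"
  proof -
    have g: "\<gamma> \<ge> 1" "\<gamma> \<le> sqrt T" using zs(2) by (simp_all add: \<gamma>_def)
    \<comment> \<open>The share of sqrt T - sqrt t spent in this round; 1 = \<delta> (2 \<gamma> -
      \<delta>) \<le> 2 \<delta> \<gamma>.\<close>
    define \<delta> where "\<delta> = \<gamma> - sqrt (length zs)"
    have "(sqrt (length zs))\<^sup>2 + 1 = \<gamma>\<^sup>2" "0 \<le> \<delta>" by (simp_all add: \<gamma>_def \<delta>_def)
    then have "1 \<le> 2 * \<delta> * \<gamma>"
      using zero_le_square[of \<delta>] unfolding \<delta>_def by (simp add: power2_eq_square algebra_simps)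
    then have d: "1 / \<gamma> \<le> 2 * \<delta>" using g by (simp add: field_simps)
    have "L \<le> l" using log_det_le_horizon[OF zs(1), of T] zs(2) by (simp add: L_def l_def)
    moreover have "0 \<le> Q" by (simp add: Q_def ridge_loss_nonneg)
    ultimately have "Q * (1 / \<gamma>) \<le> (Q - 3 * L + 3 * l) * (2 * \<delta>)"
      using d g by (intro mult_mono) auto
    moreover have "\<gamma> * s \<le> sqrt T * (2 * ln (1 + s))"
      using g q s by (intro mult_mono) auto
    moreover have "regret_potential d T w zs
        = 2 * sqrt T * (l - L) + (Q - 3 * L + 3 * l) * (2 * \<rho>) + (Q - 3 * L + 3 * l) * (2 * \<delta>)"
      by (simp add: regret_potential_def l_def L_def Q_def \<rho>_def \<delta>_def \<gamma>_def algebra_simps)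
    ultimately show ?thesis by (simp add: algebra_simps)
  qed
  finally show ?L by (simp add: \<gamma>_def s_def Q_def)
qed


section \<open>The optimistic policy\<close>

text \<open>Reversal puts the newest sample first, as \<open>ridge\<close> expects. Subtracting the
  known part leaves responses linear in the feature, up to noise.\<close>

definition user_data ::
  "(rvec \<Rightarrow> rvec) \<Rightarrow> (nat \<Rightarrow> rvec \<Rightarrow> real) \<Rightarrow> nat \<Rightarrow> hist \<Rightarrow> (rvec \<times> real) list" where
  "user_data \<phi> off u hs = map (\<lambda>(u', S, x, X). (\<phi> x, X - off u x)) (rev (filter (\<lambda>z. fst z = u) hs))"

definition optimistic_score ::
  "nat \<Rightarrow> (rvec \<Rightarrow> rvec) \<Rightarrow> (rvec \<Rightarrow> real) \<Rightarrow> (rvec \<times> real) list \<Rightarrow> rvec \<Rightarrow> real" where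
  "optimistic_score d \<phi> f zs x = f x + inner_k d (\<phi> x) (ridge d zs)
     + sqrt (1 + real (length zs)) / 2 * cov d (map fst zs) (\<phi> x) (\<phi> x)"

definition optimistic_policy :: "nat \<Rightarrow> (rvec \<Rightarrow> rvec) \<Rightarrow> (nat \<Rightarrow> rvec \<Rightarrow> real) \<Rightarrow> policy" where
  "optimistic_policy d \<phi> off h hs u S = return_pmf (SOME x. x \<in> S \<and>
     (\<forall>y\<in>S. optimistic_score d \<phi> (off u) (user_data \<phi> off u hs) y
           \<le> optimistic_score d \<phi> (off u) (user_data \<phi> off u hs) x))"

lemma user_data_snoc:
  "user_data \<phi> off u (hs @ [(v, S, x, X)])
    = (if v = u then (\<phi> x, X - off u x) # user_data \<phi> off u hs else user_data \<phi> off u hs)"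
  by (simp add: user_data_def)

lemma optimistic_policy_choice:
  assumes "finite S" "S \<noteq> {}"
  obtains x where "optimistic_policy d \<phi> off h hs u S = return_pmf x" "x \<in> S"
    "\<And>y. y \<in> S \<Longrightarrow> optimistic_score d \<phi> (off u) (user_data \<phi> off u hs) y
           \<le> optimistic_score d \<phi> (off u) (user_data \<phi> off u hs) x"
proof -
  define g where "g = optimistic_score d \<phi> (off u) (user_data \<phi> off u hs)"
  have "Max (g ` S) \<in> g ` S" using assms by simp
  then obtain x where "x \<in> S" "g x = Max (g ` S)" by auto
  then have "\<exists>x. x \<in> S \<and> (\<forall>y\<in>S. g y \<le> g x)" using assms(1) by auto
  from someI_ex[OF this] show ?thesis
    using that[of "SOME x. x \<in> S \<and> (\<forall>y\<in>S. g y \<le> g x)"] by (simp add: optimistic_policy_def g_def)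
qed

text \<open>Young's inequality with c = \<gamma> at \<open>y\<close> and c = - \<gamma> at
  \<open>x\<close> bounds each estimation error by half a bonus plus Q / (2 \<gamma>). The score
  comparison exchanges the half bonus of \<open>y\<close> for that of \<open>x\<close>.\<close>

lemma optimistic_score_regret:
  assumes "optimistic_score d \<phi> f zs y \<le> optimistic_score d \<phi> f zs x"
  shows "f y + inner_k d (\<phi> y) w \<le> f x + inner_k d (\<phi> x) w
    + sqrt (1 + real (length zs)) * cov d (map fst zs) (\<phi> x) (\<phi> x)
    + ridge_loss d w zs / sqrt (1 + real (length zs))"
proof -
  define \<gamma> where "\<gamma> = sqrt (1 + real (length zs))"
  define Q k e where "Q = ridge_loss d w zs" and "k = (\<lambda>x. cov d (map fst zs) (\<phi> x) (\<phi> x))"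
    and "e = (\<lambda>x. inner_k d (\<phi> x) (ridge_error d w zs))"
  have g: "\<gamma> > 0" by (simp add: \<gamma>_def)
  have e: "inner_k d (\<phi> x) w = inner_k d (\<phi> x) (ridge d zs) + e x" for x
    unfolding e_def ridge_error_def inner_k_add_scale_right by simp
  have young: "2 * c * e x \<le> c\<^sup>2 * k x + Q" for c x
    unfolding e_def k_def Q_def ridge_loss_def by (rule design_form_young)
  have "e y \<le> \<gamma> / 2 * k y + Q / \<gamma> / 2" "- e x \<le> \<gamma> / 2 * k x + Q / \<gamma> / 2"
    using young[of \<gamma> y] young[of "- \<gamma>" x] g by (simp_all add: field_simps power2_eq_square)
  then show ?thesis
    using assms e[of x] e[of y] unfolding optimistic_score_def \<gamma>_def[symmetric] Q_def[symmetric]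
    by (simp add: k_def)
qed

section \<open>Expected reward by backward induction\<close>

lemma ennreal_add_le:
  assumes "0 \<le> x"
  shows "ennreal (x + y) \<le> ennreal x + ennreal y"
  using assms by (cases "0 \<le> y") (auto simp: ennreal_neg intro: ennreal_leI)

text \<open>Since \<open>ennreal\<close> clips at 0, the right side integrates the positive part of
  \<open>g\<close>.\<close>

lemma ennreal_integral_le_nn_integral:
  fixes g :: "'a \<Rightarrow> real"
  assumes "integrable M g"
  shows "ennreal (\<integral>x. g x \<partial>M) \<le> (\<integral>\<^sup>+x. ennreal (g x) \<partial>M)"
proof -
  have i: "integrable M (\<lambda>x. max 0 (g x))" using assms by simp
  have "ennreal (\<integral>x. g x \<partial>M) \<le> ennreal (\<integral>x. max 0 (g x) \<partial>M)"
    by (intro ennreal_leI integral_mono assms i) simp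
  also have "\<dots> = (\<integral>\<^sup>+x. ennreal (max 0 (g x)) \<partial>M)"
    using i by (intro nn_integral_eq_integral[symmetric]) auto
  also have "\<dots> = (\<integral>\<^sup>+x. ennreal (g x) \<partial>M)"
    by (intro nn_integral_cong) (simp add: max_def ennreal_neg)
  finally show ?thesis .
qed

text \<open>The reduced problem: rewards are a known offset plus a linear function of a
  d-dimensional feature, with an unknown parameter \<open>w u\<close> for each user.\<close>

locale linear_bandit =
  fixes d b n H U :: nat and B :: rmat and \<theta> :: "nat \<Rightarrow> rvec" and us :: "nat \<Rightarrow> nat"
    and D :: "nat \<Rightarrow> rvec set" and N :: "real measure"
    and \<phi> :: "rvec \<Rightarrow> rvec" and off :: "nat \<Rightarrow> rvec \<Rightarrow> real" and w :: "nat \<Rightarrow> rvec"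
  assumes N: "subgaussian1 N"
    and us: "h < H \<Longrightarrow> us h < U"
    and D: "h < H \<Longrightarrow> finite (D h)" "h < H \<Longrightarrow> D h \<noteq> {}"
    and bounded: "h < H \<Longrightarrow> x \<in> D h \<Longrightarrow> \<bar>inner_k b x (matvec B n (\<theta> (us h)))\<bar> \<le> 1"
    and reward: "h < H \<Longrightarrow> x \<in> D h \<Longrightarrow>
      inner_k b x (matvec B n (\<theta> (us h))) = off (us h) x + inner_k d (\<phi> x) (w (us h))"
    and feature: "h < H \<Longrightarrow> x \<in> D h \<Longrightarrow> inner_k d (\<phi> x) (\<phi> x) \<le> 1"
begin

abbreviation "mean_reward h x \<equiv> inner_k b x (matvec B n (\<theta> (us h)))"
abbreviation "best_reward h \<equiv> Max (mean_reward h ` D h)"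
abbreviation "\<pi> \<equiv> optimistic_policy d \<phi> off"
abbreviation "value_to_go \<equiv> exp_shifted_reward \<pi> B b n \<theta> us D N"
abbreviation "rounds u h \<equiv> card {j. j < h \<and> us j = u}"

lemma rounds_Suc: "rounds u (Suc h) = (if us h = u then Suc (rounds u h) else rounds u h)"
proof -
  have "{j. j < Suc h \<and> us j = u} = (if us h = u then insert h {j. j < h \<and> us j = u} else {j. j < h \<and> us j = u})"
    by (auto simp: less_Suc_eq)
  then show ?thesis by simp
qed

lemma rounds_mono: "h \<le> h' \<Longrightarrow> rounds u h \<le> rounds u h'"
  by (intro card_mono) auto

text \<open>Crude, but it gives finiteness: \<open>enn2real\<close> would send an infinite value to
  0.\<close>

lemma value_to_go_le: "h + k \<le> H \<Longrightarrow> value_to_go k h hs \<le> ennreal (2 * real k)"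
proof (induction k arbitrary: h hs)
  case (Suc k)
  interpret prob_space N using N by (simp add: subgaussian1_def)
  have h: "h < H" using Suc.prems(1) by simp
  obtain x where x: "\<pi> h hs (us h) (D h) = return_pmf x" "x \<in> D h"
    using optimistic_policy_choice[OF D[OF h]] by metis
  have "(\<integral>\<^sup>+ e. value_to_go k (Suc h) (hs @ [(us h, D h, x, mean_reward h x + e)]) \<partial>N)
      \<le> (\<integral>\<^sup>+ e. ennreal (2 * real k) \<partial>N)"
    using Suc by (intro nn_integral_mono) simp
  also have "\<dots> = ennreal (2 * real k)" by (simp add: emeasure_space_1)
  finally have "value_to_go (Suc k) h hs \<le> ennreal (1 + mean_reward h x) + ennreal (2 * real k)"
    by (simp add: x add_left_mono)
  also have "\<dots> \<le> ennreal 2 + ennreal (2 * real k)"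
    using bounded[OF h x(2)] by (intro add_right_mono ennreal_leI) auto
  also have "\<dots> = ennreal (2 * real (Suc k))" by (subst ennreal_plus[symmetric]) (auto simp: algebra_simps)
  finally show ?case .
qed simp

text \<open>Only the current user's data change in a round, and that user's potential drops on
  average by at least the regret of the round. With no round left, nonnegative potentials and
  clipping at 0 make the claim trivial.\<close>

lemma value_to_go_ge:
  assumes "h + k = H"
    and "\<And>u. u < U \<Longrightarrow> length (user_data \<phi> off u hs) = rounds u h"
    and "\<And>u. u < U \<Longrightarrow> \<forall>z\<in>set (user_data \<phi> off u hs). inner_k d (fst z) (fst z) \<le> 1"
  shows "ennreal ((\<Sum>j\<in>{h..<H}. 1 + best_reward j)
      - (\<Sum>u<U. regret_potential d (rounds u H) (w u) (user_data \<phi> off u hs))) \<le> value_to_go k h hs"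
  using assms
proof (induction k arbitrary: h hs)
  case 0
  have "0 \<le> (\<Sum>u<U. regret_potential d (rounds u H) (w u) (user_data \<phi> off u hs))"
    using 0 by (intro sum_nonneg regret_potential_nonneg) auto
  then show ?case using 0 by (simp add: ennreal_neg)
next
  case (Suc k)
  interpret prob_space N using N by (simp add: subgaussian1_def)
  have h: "h < H" using Suc.prems(1) by simp
  define v where "v = us h"
  have v: "v < U" using us[OF h] by (simp add: v_def)
  obtain x where x: "\<pi> h hs v (D h) = return_pmf x" "x \<in> D h"
    and best: "\<And>y. y \<in> D h \<Longrightarrow> optimistic_score d \<phi> (off v) (user_data \<phi> off v hs) y
           \<le> optimistic_score d \<phi> (off v) (user_data \<phi> off v hs) x"
    using optimistic_policy_choice[OF D[OF h]] by metis
  define zs where "zs = user_data \<phi> off v hs"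
  define hs' where "hs' = (\<lambda>e. hs @ [(v, D h, x, mean_reward h x + e)])"
  have data': "user_data \<phi> off u (hs' e)
      = (if u = v then (\<phi> x, inner_k d (\<phi> x) (w v) + e) # zs else user_data \<phi> off u hs)" for u e
    using reward[OF h x(2)] by (auto simp: hs'_def user_data_snoc zs_def v_def)
  define pot where "pot = (\<lambda>u. regret_potential d (rounds u H) (w u))"
  have split: "(\<Sum>u<U. f u) = f v + (\<Sum>u\<in>{..<U} - {v}. f u)" for f :: "nat \<Rightarrow> real"
    using v by (simp add: sum.remove)
  define F where "F = (\<Sum>j\<in>{Suc h..<H}. 1 + best_reward j)"
  define P where "P = (\<Sum>u\<in>{..<U} - {v}. pot u (user_data \<phi> off u hs))"
  \<comment> \<open>An integrable minorant of the value after noise \<open>e\<close>, whose mean is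
    an ordinary integral.\<close>
  define g where "g = (\<lambda>e. F - (pot v ((\<phi> x, inner_k d (\<phi> x) (w v) + e) # zs) + P))"
  have IH: "ennreal (g e) \<le> value_to_go k (Suc h) (hs' e)" for e
  proof -
    have "ennreal (F - (\<Sum>u<U. pot u (user_data \<phi> off u (hs' e)))) \<le> value_to_go k (Suc h) (hs' e)"
      unfolding F_def pot_def
    proof (rule Suc.IH)
      show "Suc h + k = H" using Suc.prems(1) by simp
      show "length (user_data \<phi> off u (hs' e)) = rounds u (Suc h)" if "u < U" for u
        unfolding rounds_Suc using Suc.prems(2)[OF that] by (simp add: data' zs_def v_def)
      show "\<forall>z\<in>set (user_data \<phi> off u (hs' e)). inner_k d (fst z) (fst z) \<le> 1" if "u < U" for u
        using Suc.prems(3)[OF that] Suc.prems(3)[OF v] feature[OF h x(2)] by (auto simp: data' zs_def)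
    qed
    also have "F - (\<Sum>u<U. pot u (user_data \<phi> off u (hs' e))) = g e"
      unfolding split by (simp add: data' g_def P_def)
    finally show ?thesis .
  qed
  have zs: "\<forall>z\<in>set zs. inner_k d (fst z) (fst z) \<le> 1" "Suc (length zs) \<le> rounds v H"
    using Suc.prems(2,3)[OF v] rounds_mono[of "Suc h" H v] h unfolding rounds_Suc
    by (auto simp: zs_def v_def)
  note step = regret_potential_Cons[OF N zs feature[OF h x(2)], of "w v"]
  have ig: "integrable N g" unfolding g_def pot_def using step(1) by simp
  have "best_reward h \<le> mean_reward h x
      + sqrt (1 + real (length zs)) * cov d (map fst zs) (\<phi> x) (\<phi> x) + ridge_loss d (w v) zs / sqrt (1 + real (length zs))"
  proof (rule Max.boundedI)
    fix r assume "r \<in> mean_reward h ` D h"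
    then obtain y where y: "y \<in> D h" "r = mean_reward h y" by auto
    show "r \<le> mean_reward h x
      + sqrt (1 + real (length zs)) * cov d (map fst zs) (\<phi> x) (\<phi> x) + ridge_loss d (w v) zs / sqrt (1 + real (length zs))"
      using optimistic_score_regret[OF best[OF y(1)], of "w v"] reward[OF h x(2)] reward[OF h y(1)] y(2)
      by (simp add: zs_def v_def)
  qed (use D h in auto)
  moreover have "(\<integral>e. g e \<partial>N)
      = F - ((\<integral>e. pot v ((\<phi> x, inner_k d (\<phi> x) (w v) + e) # zs) \<partial>N) + P)"
    unfolding g_def pot_def using step(1) by (simp add: prob_space)
  ultimately have "1 + best_reward h + F - (\<Sum>u<U. pot u (user_data \<phi> off u hs))
      \<le> 1 + mean_reward h x + (\<integral>e. g e \<partial>N)"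
    using step(2) unfolding split by (simp add: P_def pot_def zs_def)
  moreover have "(\<Sum>j\<in>{h..<H}. 1 + best_reward j) = 1 + best_reward h + F"
    unfolding F_def using h by (simp add: sum.atLeast_Suc_lessThan)
  ultimately have "ennreal ((\<Sum>j\<in>{h..<H}. 1 + best_reward j) - (\<Sum>u<U. pot u (user_data \<phi> off u hs)))
      \<le> ennreal (1 + mean_reward h x + (\<integral>e. g e \<partial>N))"
    by (intro ennreal_leI) simp
  \<comment> \<open>The integral of \<open>g\<close> may be negative; the split is sound because the
    shifted mean reward is not.\<close>
  also have "\<dots> \<le> ennreal (1 + mean_reward h x) + ennreal (\<integral>e. g e \<partial>N)"
    using bounded[OF h x(2)] by (intro ennreal_add_le) auto
  also have "\<dots> \<le> ennreal (1 + mean_reward h x) + (\<integral>\<^sup>+e. value_to_go k (Suc h) (hs' e) \<partial>N)"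
    by (intro add_left_mono order_trans[OF ennreal_integral_le_nn_integral[OF ig]] nn_integral_mono IH)
  also have "\<dots> = value_to_go (Suc k) h hs"
    using x(1) by (simp add: hs'_def v_def)
  finally show ?case by (simp add: pot_def)
qed

text \<open>At the empty history the shifts by 1 sum to H and cancel; finiteness carries the
  inequality over to the reals.\<close>

lemma regret_le_potential:
  "regret \<pi> B b n \<theta> us D N H \<le> (\<Sum>u<U. regret_potential d (rounds u H) (w u) [])"
proof -
  let ?P = "\<Sum>u<U. regret_potential d (rounds u H) (w u) []"
  have "ennreal ((\<Sum>j<H. 1 + best_reward j) - ?P) \<le> value_to_go H 0 []"
    using value_to_go_ge[of 0 H "[]"] by (simp add: user_data_def atLeast0LessThan)
  moreover have "value_to_go H 0 [] < \<top>"
    by (rule le_less_trans[OF value_to_go_le ennreal_less_top]) simp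
  ultimately have "ennreal ((\<Sum>j<H. 1 + best_reward j) - ?P)
      \<le> ennreal (enn2real (value_to_go H 0 []))"
    by (simp only: ennreal_enn2real)
  then have "(\<Sum>j<H. 1 + best_reward j) - ?P \<le> enn2real (value_to_go H 0 [])"
    by (simp only: ennreal_le_iff[OF enn2real_nonneg])
  then show ?thesis by (simp add: regret_def sum.distrib)
qed

lemma sum_rounds: "(\<Sum>u<U. rounds u H) = H"
proof -
  have "(\<Sum>u<U. rounds u H) = card (\<Union>u<U. {j. j < H \<and> us j = u})"
    by (intro card_UN_disjoint[symmetric]) auto
  also have "(\<Union>u<U. {j. j < H \<and> us j = u}) = {..<H}" using us by auto
  finally show ?thesis by simp
qed

end

section \<open>Orthonormal families adapted to the common information\<close>

text \<open>Gaussian elimination: a pivot unknown is solved from the last equation and substituted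
  into the others.\<close>

lemma homogeneous_system_nontrivial:
  fixes m :: "'a \<Rightarrow> nat \<Rightarrow> real"
  assumes "finite I" "p < card I"
  shows "\<exists>c. (\<exists>i\<in>I. c i \<noteq> 0) \<and> (\<forall>j<p. (\<Sum>i\<in>I. c i * m i j) = 0)"
  using assms
proof (induction p arbitrary: I m)
  case 0
  then have "I \<noteq> {}" by auto
  then show ?case by (intro exI[of _ "\<lambda>_. 1"]) auto
next
  case (Suc p)
  show ?case
  proof (cases "\<forall>i\<in>I. m i p = 0")
    case True
    obtain c where c: "\<exists>i\<in>I. c i \<noteq> 0" "\<forall>j<p. (\<Sum>i\<in>I. c i * m i j) = 0"
      using Suc.IH[of I m] Suc.prems by auto
    have "(\<Sum>i\<in>I. c i * m i p) = 0" using True by simp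
    then have "\<forall>j<Suc p. (\<Sum>i\<in>I. c i * m i j) = 0" using c(2) by (simp add: less_Suc_eq)
    then show ?thesis using c(1) by blast
  next
    case False
    then obtain i0 where i0: "i0 \<in> I" "m i0 p \<noteq> 0" by auto
    define I' where "I' = I - {i0}"
    have I': "finite I'" "p < card I'" "i0 \<notin> I'" "I = insert i0 I'"
      using Suc.prems i0(1) by (auto simp: I'_def)
    define m' where "m' = (\<lambda>i j. m i j - m i p / m i0 p * m i0 j)"
    obtain c where c: "\<exists>i\<in>I'. c i \<noteq> 0" "\<forall>j<p. (\<Sum>i\<in>I'. c i * m' i j) = 0"
      using Suc.IH[OF I'(1,2), of m'] by auto
    \<comment> \<open>The pivot's value enforces equation \<open>p\<close>; substituting it turns
      the coefficients \<open>m\<close> into \<open>m'\<close>.\<close>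
    define c' where "c' = c(i0 := - (\<Sum>i\<in>I'. c i * m i p) / m i0 p)"
    have s: "(\<Sum>i\<in>I. c' i * m i j) = (\<Sum>i\<in>I'. c i * m' i j)" for j
    proof -
      have "(\<Sum>i\<in>I. c' i * m i j) = c' i0 * m i0 j + (\<Sum>i\<in>I'. c' i * m i j)"
        using I' by simp
      also have "(\<Sum>i\<in>I'. c' i * m i j) = (\<Sum>i\<in>I'. c i * m i j)"
        using I'(3) by (intro sum.cong) (auto simp: c'_def)
      also have "c' i0 * m i0 j = (\<Sum>i\<in>I'. - (c i * (m i p / m i0 p * m i0 j)))"
        by (simp add: c'_def sum_divide_distrib sum_distrib_left sum_distrib_right sum_negf mult_ac)
      finally show ?thesis by (simp add: m'_def sum.distrib[symmetric] algebra_simps)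
    qed
    have "(\<Sum>i\<in>I. c' i * m i j) = 0" if "j < Suc p" for j
    proof (cases "j = p")
      case True
      then show ?thesis unfolding s using i0(2) by (simp add: m'_def)
    next
      case False
      then show ?thesis unfolding s using c(2) that by simp
    qed
    moreover have "\<exists>i\<in>I. c' i \<noteq> 0" using c(1) I' by (auto simp: c'_def)
    ultimately show ?thesis by blast
  qed
qed

section \<open>Orthogonal projection and Gram-Schmidt extension\<close>

definition orthonormal_fam :: "nat \<Rightarrow> nat \<Rightarrow> (nat \<Rightarrow> rvec) \<Rightarrow> bool" where
  "orthonormal_fam b m f \<longleftrightarrow> (\<forall>i<m. \<forall>j<m. inner_k b (f i) (f j) = (if i = j then 1 else 0))"

definition linear_closed :: "rvec set \<Rightarrow> bool" where
  "linear_closed S \<longleftrightarrow> (\<lambda>i. 0) \<in> S \<and> (\<forall>x\<in>S. \<forall>y\<in>S. \<forall>c. (\<lambda>i. x i + c * y i) \<in> S)"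

definition residual :: "nat \<Rightarrow> nat \<Rightarrow> (nat \<Rightarrow> rvec) \<Rightarrow> rvec \<Rightarrow> rvec" where
  "residual b m f x = (\<lambda>i. x i + (- 1) * (\<Sum>j<m. inner_k b x (f j) * f j i))"

lemma linear_closedD:
  "linear_closed S \<Longrightarrow> x \<in> S \<Longrightarrow> y \<in> S \<Longrightarrow> (\<lambda>i. x i + c * y i) \<in> S"
  by (simp add: linear_closed_def)

lemma linear_closed_sum:
  fixes m :: nat
  assumes "linear_closed S" "\<And>j. j < m \<Longrightarrow> f j \<in> S"
  shows "(\<lambda>i. \<Sum>j<m. c j * f j i) \<in> S"
  using assms(2)
proof (induction m)
  case 0
  then show ?case using assms(1) by (simp add: linear_closed_def)
next
  case (Suc m)
  have "(\<lambda>i. \<Sum>j<m. c j * f j i) \<in> S" "f m \<in> S" using Suc by auto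
  then have "(\<lambda>i. (\<Sum>j<m. c j * f j i) + c m * f m i) \<in> S"
    by (rule linear_closedD[OF assms(1)])
  then show ?case by simp
qed

lemma inner_k_fam_sum:
  assumes "orthonormal_fam b m f" "j < m"
  shows "inner_k b (\<lambda>i. \<Sum>l<m. c l * f l i) (f j) = c j"
proof -
  have "(\<Sum>l<m. c l * inner_k b (f l) (f j)) = (\<Sum>l<m. if l = j then c j else 0)"
    using assms by (intro sum.cong) (auto simp: orthonormal_fam_def)
  then show ?thesis using assms(2) by (simp add: inner_k_sum_left)
qed

lemma inner_k_residual_fam:
  "orthonormal_fam b m f \<Longrightarrow> j < m \<Longrightarrow> inner_k b (residual b m f x) (f j) = 0"
  unfolding residual_def inner_k_add_scale_left
  using inner_k_fam_sum[of b m f j "\<lambda>j. inner_k b x (f j)"] by simp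

text \<open>Pythagoras: the residual is orthogonal to the projection.\<close>

lemma inner_k_residual_self:
  assumes "orthonormal_fam b m f"
  shows "inner_k b (residual b m f x) (residual b m f x)
    = inner_k b x x - (\<Sum>j<m. (inner_k b x (f j))\<^sup>2)"
proof -
  let ?r = "residual b m f x" and ?p = "\<lambda>i. \<Sum>j<m. inner_k b x (f j) * f j i"
  have "inner_k b ?p ?r = (\<Sum>j<m. inner_k b x (f j) * inner_k b ?r (f j))"
    unfolding inner_k_sum_left by (simp add: inner_k_commute)
  also have "\<dots> = 0" using inner_k_residual_fam[OF assms] by simp
  finally have "inner_k b ?r ?r = inner_k b x ?r"
    by (subst (1) residual_def) (simp add: inner_k_add_scale_left[where c = "- 1", simplified])
  also have "\<dots> = inner_k b x x - inner_k b x ?p"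
    unfolding residual_def inner_k_add_scale_right by simp
  also have "inner_k b x ?p = (\<Sum>j<m. (inner_k b x (f j))\<^sup>2)"
    by (subst inner_k_commute) (simp add: inner_k_sum_left inner_k_commute power2_eq_square)
  finally show ?thesis .
qed

lemma bessel:
  "orthonormal_fam b m f \<Longrightarrow> (\<Sum>j<m. (inner_k b x (f j))\<^sup>2) \<le> inner_k b x x"
  using inner_k_residual_self[of b m f x] inner_k_self_nonneg[of b "residual b m f x"] by simp

text \<open>Double counting of squared entries: each of the \<open>m\<close> vectors contributes 1,
  and by Bessel's inequality for unit vectors each of the \<open>b\<close> coordinates contributes
  at most 1.\<close>

lemma orthonormal_fam_card_le:
  assumes "orthonormal_fam b m f"
  shows "m \<le> b"
proof -
  have "real m = (\<Sum>j<m. inner_k b (f j) (f j))"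
    using assms by (simp add: orthonormal_fam_def)
  also have "\<dots> = (\<Sum>i<b. \<Sum>j<m. (f j i)\<^sup>2)"
    unfolding inner_k_def power2_eq_square by (rule sum.swap)
  also have "\<dots> \<le> (\<Sum>i<b. 1)"
  proof (rule sum_mono)
    fix i assume "i \<in> {..<b}"
    then have "inner_k b (unit_vec i) v = v i" for v
      using inner_k_unit_vec[of i b v] by (simp add: inner_k_commute)
    then show "(\<Sum>j<m. (f j i)\<^sup>2) \<le> 1"
      using bessel[OF assms, of "unit_vec i"] by (simp add: unit_vec_def)
  qed
  finally show ?thesis by simp
qed

text \<open>Gram-Schmidt: while some residual in \<open>S\<close> is nonzero, its normalisation
  extends the family. The size bound \<open>b\<close> ends the process.\<close>

lemma orthonormal_fam_maximal:
  assumes S: "linear_closed S" and f: "orthonormal_fam b m f" "\<And>j. j < m \<Longrightarrow> f j \<in> S"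
  obtains M g where "m \<le> M" "\<And>j. j < m \<Longrightarrow> g j = f j" "orthonormal_fam b M g"
    "\<And>j. j < M \<Longrightarrow> g j \<in> S"
    "\<And>x i. x \<in> S \<Longrightarrow> i < b \<Longrightarrow> residual b M g x i = 0"
  using f
proof (induction "b - m" arbitrary: m f thesis rule: less_induct)
  case less
  show ?case
  proof (cases "\<forall>x\<in>S. \<forall>i<b. residual b m f x i = 0")
    case True
    then show ?thesis using less.prems(1)[of m f] less.prems(2,3) by blast
  next
    case False
    then obtain x i where x: "x \<in> S" "i < b" "residual b m f x i \<noteq> 0" by auto
    define r where "r = residual b m f x"
    have rr: "inner_k b r r > 0"
      using inner_k_self_eq_0[of b r i] inner_k_self_nonneg[of b r] x by (force simp: r_def)
    have rS: "r \<in> S"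
      unfolding r_def residual_def using x(1) less.prems(3) by (intro linear_closedD linear_closed_sum S)
    define c where "c = 1 / sqrt (inner_k b r r)"
    \<comment> \<open>The summand 0 gives \<open>y\<close> the shape to which closure and linearity
      of \<open>inner_k\<close> apply.\<close>
    define y :: rvec where "y = (\<lambda>i. 0 + c * r i)"
    have yS: "y \<in> S" unfolding y_def using S rS by (intro linear_closedD) (auto simp: linear_closed_def)
    have z: "inner_k b (\<lambda>i. 0) v = 0" "inner_k b v (\<lambda>i. 0) = 0" for v by (simp_all add: inner_k_def)
    have yy: "inner_k b y y = 1"
      unfolding y_def inner_k_add_scale_left inner_k_add_scale_right z
      using rr by (simp add: c_def flip: power2_eq_square)
    have yf: "inner_k b y (f j) = 0" if "j < m" for j
      unfolding y_def inner_k_add_scale_left z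
      using inner_k_residual_fam[OF less.prems(2) that] by (simp add: r_def)
    have fy: "inner_k b (f j) y = 0" if "j < m" for j
      using yf[OF that] by (simp add: inner_k_commute)
    have on: "orthonormal_fam b (Suc m) (f(m := y))"
      using less.prems(2) yy yf fy unfolding orthonormal_fam_def by (auto simp: less_Suc_eq)
    then have lt: "b - Suc m < b - m" using orthonormal_fam_card_le[OF on] by simp
    have inS: "(f(m := y)) j \<in> S" if "j < Suc m" for j
      using that less.prems(3) yS by (auto simp: less_Suc_eq)
    obtain M g where "Suc m \<le> M" "\<And>j. j < Suc m \<Longrightarrow> g j = (f(m := y)) j"
      "orthonormal_fam b M g" "\<And>j. j < M \<Longrightarrow> g j \<in> S"
      "\<And>x i. x \<in> S \<Longrightarrow> i < b \<Longrightarrow> residual b M g x i = 0"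
      using less.hyps[OF lt _ on inS] by metis
    then show ?thesis using less.prems(1)[of M g] by force
  qed
qed

lemma inner_k_eq_sum_fam:
  assumes "\<And>x i. i < b \<Longrightarrow> residual b M g x i = 0"
  shows "inner_k b x v = (\<Sum>j<M. inner_k b x (g j) * inner_k b (g j) v)"
proof -
  have "x i = (\<Sum>j<M. inner_k b x (g j) * g j i)" if "i < b" for i
    using assms[OF that, of x] by (simp add: residual_def)
  then have "inner_k b x v = inner_k b (\<lambda>i. \<Sum>j<M. inner_k b x (g j) * g j i) v"
    by (intro inner_k_cong) auto
  then show ?thesis by (simp add: inner_k_sum_left)
qed

text \<open>\<open>GREATEST\<close> is meaningful only for bounded lengths; more than
  \<open>n\<close> vectors with \<open>n\<close> relevant coordinates are dependent.\<close>

lemma subspace_dim_attained: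
  assumes "\<And>w j. w \<in> V \<Longrightarrow> j \<ge> n \<Longrightarrow> w j = 0"
  obtains v where "\<And>i. i < subspace_dim V \<Longrightarrow> v i \<in> V" "lin_indep_fam (subspace_dim V) v"
proof -
  let ?P = "\<lambda>l. \<exists>v. (\<forall>i<l. v i \<in> V) \<and> lin_indep_fam l v"
  have bound: "l \<le> n" if l: "?P l" for l
  proof (rule ccontr)
    assume "\<not> l \<le> n"
    obtain v where v: "\<forall>i<l. v i \<in> V" "lin_indep_fam l v" using l by blast
    obtain c where c: "\<exists>i\<in>{..<l}. c i \<noteq> 0" "\<forall>j<n. (\<Sum>i<l. c i * v i j) = 0"
      using homogeneous_system_nontrivial[of "{..<l}" n v] \<open>\<not> l \<le> n\<close> by auto
    have "(\<Sum>i<l. c i * v i j) = 0" for j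
    proof (cases "j < n")
      case False
      then show ?thesis using v(1) assms by (intro sum.neutral) auto
    qed (use c in simp)
    then show False using v(2) c(1) unfolding lin_indep_fam_def by auto
  qed
  have "?P 0" by (simp add: lin_indep_fam_def)
  then have "?P (subspace_dim V)"
    unfolding subspace_dim_def by (rule GreatestI_nat[where P = ?P]) (rule bound)
  then show ?thesis using that by blast
qed

text \<open>The rewards in the directions \<open>x\<close> with $B^T x \in \mathrm{Row}(A)$ are known in advance;
  \<open>\<phi>\<close> gives the coordinates with respect to an orthonormal basis of the complement
  of these directions in $R^b$.\<close>

lemma reward_decomposition:
  fixes A B :: rmat
  obtains d :: nat and \<phi> :: "rvec \<Rightarrow> rvec" and known :: "rvec \<Rightarrow> rvec \<Rightarrow> real" where
    "d + subspace_dim (row_space A a n \<inter> row_space B b n) \<le> b"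
    "\<And>x. inner_k d (\<phi> x) (\<phi> x) \<le> inner_k b x x"
    "\<And>x \<theta> y. \<forall>i<a. matvec A n \<theta> i = y i \<Longrightarrow>
       inner_k b x (matvec B n \<theta>) = known y x + inner_k d (\<phi> x) (\<phi> (matvec B n \<theta>))"
proof -
  let ?V = "row_space A a n \<inter> row_space B b n"
  define k where "k = subspace_dim ?V"
  define S :: "rvec set" where
    "S = {x. \<exists>c. \<forall>j<n. (\<Sum>i<b. x i * B i j) = (\<Sum>r<a. c r * A r j)}"
  have S: "linear_closed S"
    unfolding linear_closed_def
  proof (intro conjI ballI allI)
    show "(\<lambda>i. 0) \<in> S" by (auto simp: S_def intro!: exI[of _ "\<lambda>_. 0"])
    fix x y and c :: real assume "x \<in> S" "y \<in> S"
    then obtain cx cy where "\<forall>j<n. (\<Sum>i<b. x i * B i j) = (\<Sum>r<a. cx r * A r j)"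
      "\<forall>j<n. (\<Sum>i<b. y i * B i j) = (\<Sum>r<a. cy r * A r j)" by (auto simp: S_def)
    then have "\<forall>j<n. (\<Sum>i<b. (x i + c * y i) * B i j) = (\<Sum>r<a. (cx r + c * cy r) * A r j)"
      by (simp add: distrib_right sum.distrib mult.assoc flip: sum_distrib_left)
    then show "(\<lambda>i. x i + c * y i) \<in> S" unfolding S_def by (intro CollectI exI)
  qed
  \<comment> \<open>Starting from the empty family yields an orthonormal basis of the known
    directions, which is then completed to one of R^b.\<close>
  obtain p f where f: "orthonormal_fam b p f" "\<And>j. j < p \<Longrightarrow> f j \<in> S"
    "\<And>x i. x \<in> S \<Longrightarrow> i < b \<Longrightarrow> residual b p f x i = 0"
    using orthonormal_fam_maximal[OF S, of b 0 "\<lambda>_ _. 0"] by (auto simp: orthonormal_fam_def)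
  have "linear_closed (UNIV :: rvec set)" by (simp add: linear_closed_def)
  from orthonormal_fam_maximal[OF this f(1)]
  obtain M g where g: "p \<le> M" "\<And>j. j < p \<Longrightarrow> g j = f j" "orthonormal_fam b M g"
    "\<And>x i. i < b \<Longrightarrow> residual b M g x i = 0" by auto
  \<comment> \<open>Independent vectors of the intersection are images B^T s_i with s_i in
    \<open>S\<close>. If k > p, a nontrivial combination of the s_i is orthogonal to all of
    \<open>f\<close>, hence zero, and so is its image.\<close>
  have kp: "k \<le> p"
  proof (rule ccontr)
    assume "\<not> k \<le> p"
    obtain v where v: "\<And>i. i < k \<Longrightarrow> v i \<in> ?V" "lin_indep_fam k v"
      using subspace_dim_attained[of ?V n] unfolding k_def by (auto simp: row_space_def)
    have "\<exists>s. \<forall>j<n. v i j = (\<Sum>r<b. s r * B r j)" if "i < k" for i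
      using v(1)[OF that] by (auto simp: row_space_def)
    then obtain s where s: "\<And>i j. i < k \<Longrightarrow> j < n \<Longrightarrow> v i j = (\<Sum>r<b. s i r * B r j)" by metis
    have sS: "s i \<in> S" if "i < k" for i
      using v(1)[OF that] s[OF that] by (auto simp: S_def row_space_def)
    obtain c where c: "\<exists>i\<in>{..<k}. c i \<noteq> 0" "\<forall>j<p. (\<Sum>i<k. c i * inner_k b (s i) (f j)) = 0"
      using homogeneous_system_nontrivial[of "{..<k}" p "\<lambda>i j. inner_k b (s i) (f j)"]
        \<open>\<not> k \<le> p\<close> by auto
    define y where "y = (\<lambda>r. \<Sum>i<k. c i * s i r)"
    have "y \<in> S" unfolding y_def using sS by (intro linear_closed_sum S)
    moreover have "inner_k b y (f j) = 0" if "j < p" for j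
      using c(2) that by (simp add: y_def inner_k_sum_left)
    ultimately have y0: "y r = 0" if "r < b" for r
      using f(3)[of y r] that by (simp add: residual_def)
    have "(\<Sum>i<k. c i * v i j) = 0" for j
    proof (cases "j < n")
      case True
      then have "(\<Sum>i<k. c i * v i j) = (\<Sum>i<k. \<Sum>r<b. c i * s i r * B r j)"
        using s by (simp add: sum_distrib_left mult.assoc)
      also have "\<dots> = (\<Sum>r<b. y r * B r j)"
        unfolding y_def sum_distrib_right by (rule sum.swap)
      finally show ?thesis using y0 by simp
    next
      case False
      then show ?thesis using v(1) by (intro sum.neutral) (auto simp: row_space_def)
    qed
    then show False using v(2) c(1) unfolding lin_indep_fam_def by auto
  qed
  have "\<forall>i. \<exists>c. i < p \<longrightarrow> (\<forall>j<n. (\<Sum>l<b. f i l * B l j) = (\<Sum>r<a. c r * A r j))"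
    using f(2) by (auto simp: S_def)
  then obtain C where C: "\<And>i j. i < p \<Longrightarrow> j < n \<Longrightarrow> (\<Sum>l<b. f i l * B l j) = (\<Sum>r<a. C i r * A r j)"
    by metis
  \<comment> \<open>Moving B to the other side turns the reward along f_i into a combination of the
    entries of A \<theta>, with coefficients independent of \<theta>.\<close>
  have known: "inner_k b (f i) (matvec B n \<theta>) = (\<Sum>r<a. C i r * matvec A n \<theta> r)" if "i < p" for i \<theta>
  proof -
    have swap: "(\<Sum>l<q. x l * matvec X n \<theta> l) = (\<Sum>j<n. (\<Sum>l<q. x l * X l j) * \<theta> j)"
      for q x and X :: rmat
      unfolding matvec_def sum_distrib_left sum_distrib_right mult.assoc by (rule sum.swap)
    show ?thesis unfolding inner_k_def swap using C[OF that] by simp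
  qed
  define d where "d = M - p"
  define \<phi> :: "rvec \<Rightarrow> rvec" where "\<phi> = (\<lambda>x i. inner_k b x (g (p + i)))"
  have split: "(\<Sum>j<M. h j) = (\<Sum>j<p. h j) + (\<Sum>i<d. h (p + i))" for h :: "nat \<Rightarrow> real"
  proof -
    have "(\<Sum>j<p + d. h j) = (\<Sum>j<p. h j) + (\<Sum>i<d. h (p + i))"
      by (induction d) (simp_all add: add.assoc)
    then show ?thesis using g(1) by (simp add: d_def)
  qed
  show thesis
  proof (rule that[of d \<phi> "\<lambda>y x. \<Sum>i<p. inner_k b x (f i) * (\<Sum>r<a. C i r * y r)"])
    show "d + subspace_dim ?V \<le> b"
      using kp g(1) orthonormal_fam_card_le[OF g(3)] by (simp add: d_def k_def)
    show "inner_k d (\<phi> x) (\<phi> x) \<le> inner_k b x x" for x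
    proof -
      have "inner_k d (\<phi> x) (\<phi> x) = (\<Sum>i<d. (inner_k b x (g (p + i)))\<^sup>2)"
        by (simp add: inner_k_def[of d] \<phi>_def power2_eq_square)
      also have "\<dots> \<le> (\<Sum>j<M. (inner_k b x (g j))\<^sup>2)" unfolding split by (simp add: sum_nonneg)
      finally show ?thesis using bessel[OF g(3), of x] by simp
    qed
    fix x \<theta> and y :: rvec
    assume y: "\<forall>i<a. matvec A n \<theta> i = y i"
    show "inner_k b x (matvec B n \<theta>) = (\<Sum>i<p. inner_k b x (f i) * (\<Sum>r<a. C i r * y r))
        + inner_k d (\<phi> x) (\<phi> (matvec B n \<theta>))"
    proof -
      have "inner_k b x (matvec B n \<theta>) = (\<Sum>j<M. inner_k b x (g j) * inner_k b (g j) (matvec B n \<theta>))"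
        using g(4) by (rule inner_k_eq_sum_fam)
      then show ?thesis
        unfolding split using g(2) known y
        by (simp add: inner_k_def[of d] \<phi>_def inner_k_commute[of b "matvec B n \<theta>"])
    qed
  qed
qed


section \<open>Summation over the users\<close>

text \<open>The initial loss is the squared norm of \<open>w\<close>, which is at most
  \<open>d\<close> even for d = 0, where it vanishes. Hence the whole bound carries the factor
  \<open>d\<close>.\<close>

lemma regret_potential_Nil_le:
  assumes "inner_k d w w \<le> 1"
  shows "regret_potential d T w [] \<le> d * (sqrt T * (2 + 8 * ln (1 + real T)))"
proof -
  have "inner_k d w w \<le> d"
    using assms by (cases d) (auto simp: inner_k_def)
  then have "inner_k d w w * (2 * sqrt T) \<le> d * (2 * sqrt T)" by (intro mult_right_mono) auto
  then show ?thesis by (simp add: regret_potential_def ridge_loss_Nil algebra_simps)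
qed

text \<open>Follows from 1 + z \<le> (1 + sqrt z)^2.\<close>

lemma ln_one_plus_le_sqrt:
  fixes z :: real
  assumes "z \<ge> 0"
  shows "ln (1 + z) \<le> 2 * sqrt z"
proof -
  have "ln (1 + z) \<le> ln ((1 + sqrt z)\<^sup>2)"
    using assms by (subst ln_le_cancel_iff) (auto simp: power2_sum add_pos_nonneg)
  also have "\<dots> = 2 * ln (1 + sqrt z)"
    using assms by (simp add: ln_realpow add_pos_nonneg)
  also have "ln (1 + sqrt z) \<le> sqrt z" using assms by (intro ln_add_one_self_le_self) simp
  finally show ?thesis by simp
qed

lemma sum_sqrt_log_le:
  fixes T :: "nat \<Rightarrow> nat"
  assumes U: "U \<ge> 1" "H \<ge> 2 * U" and T: "(\<Sum>u<U. T u) = H"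
  shows "(\<Sum>u<U. sqrt (T u) * (2 + 8 * ln (1 + real (T u))))
    \<le> 43 * sqrt (real U * real H) * ln (real H / real U)"
proof -
  define \<rho> where "\<rho> = real H / real U"
  have r: "\<rho> \<ge> 2" using U by (simp add: \<rho>_def field_simps)
  have UH: "sqrt (real U * real H) = U * sqrt \<rho>"
    using U by (simp add: \<rho>_def real_sqrt_mult real_sqrt_divide field_simps)
  have TH: "(\<Sum>u<U. real (T u)) = U * \<rho>"
    using T U by (simp add: \<rho>_def flip: of_nat_sum)
  define K where "K = 2 + 8 * ln (1 + \<rho>)"
  have K: "K \<ge> 0" using r by (simp add: K_def)
  text \<open>A logarithm of \<open>H / U\<close> rather than of \<open>H\<close> survives because a user with
    $T_u > H / U$ rounds pays the excess in $\sqrt{T_u U / H}$ instead.\<close>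
  have "sqrt (T u) * (2 + 8 * ln (1 + real (T u)))
      \<le> sqrt \<rho> * K * ((1 + T u / \<rho>) / 2) + 16 * (T u / sqrt \<rho>)" for u
  proof -
    let ?t = "real (T u)"
    have "(1 + \<rho>) * (1 + ?t / \<rho>) = 1 + ?t + (\<rho> + ?t / \<rho>)"
      using r by (simp add: field_simps)
    moreover have "0 \<le> \<rho> + ?t / \<rho>" using r by simp
    ultimately have "ln (1 + ?t) \<le> ln ((1 + \<rho>) * (1 + ?t / \<rho>))"
      by (subst ln_le_cancel_iff) auto
    also have "\<dots> = ln (1 + \<rho>) + ln (1 + ?t / \<rho>)"
      using r by (intro ln_mult_pos) (auto simp: add_pos_nonneg)
    also have "ln (1 + ?t / \<rho>) \<le> 2 * sqrt (?t / \<rho>)" using r by (intro ln_one_plus_le_sqrt) simp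
    finally have "sqrt ?t * (2 + 8 * ln (1 + ?t)) \<le> sqrt ?t * (K + 16 * sqrt (?t / \<rho>))"
      unfolding K_def by (intro mult_left_mono) auto
    also have "\<dots> = sqrt ?t * K + 16 * (?t / sqrt \<rho>)"
      by (simp add: distrib_left real_sqrt_divide flip: real_sqrt_mult_self[of ?t])
    \<comment> \<open>The arithmetic-geometric mean inequality replaces the square root by an affine
      function of \<open>?t\<close>, so only the total number of rounds matters after
      summation.\<close>
    also have "sqrt ?t * K \<le> (sqrt \<rho> * ((1 + ?t / \<rho>) / 2)) * K"
    proof (rule mult_right_mono[OF _ K])
      have "sqrt \<rho> * sqrt (?t / \<rho>) \<le> sqrt \<rho> * ((1 + ?t / \<rho>) / 2)"
        using arith_geo_mean_sqrt[of 1 "?t / \<rho>"] r by (intro mult_left_mono) auto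
      then show "sqrt ?t \<le> sqrt \<rho> * ((1 + ?t / \<rho>) / 2)"
        using r by (simp add: real_sqrt_divide)
    qed
    finally show ?thesis by (simp add: mult_ac)
  qed
  then have "(\<Sum>u<U. sqrt (T u) * (2 + 8 * ln (1 + real (T u))))
      \<le> (\<Sum>u<U. sqrt \<rho> * K * ((1 + T u / \<rho>) / 2) + 16 * (T u / sqrt \<rho>))"
    by (intro sum_mono)
  also have "\<dots> = sqrt \<rho> * K * ((U + (\<Sum>u<U. real (T u)) / \<rho>) / 2) + 16 * ((\<Sum>u<U. real (T u)) / sqrt \<rho>)"
    by (simp add: sum.distrib sum_distrib_left sum_divide_distrib add_divide_distrib distrib_left mult_ac)
  also have "\<dots> = (U * sqrt \<rho>) * (K + 16)"
  proof -
    have "\<rho> / sqrt \<rho> = sqrt \<rho>" using r by (simp add: real_div_sqrt)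
    then have "U * \<rho> / sqrt \<rho> = U * sqrt \<rho>" by (metis times_divide_eq_right)
    then show ?thesis unfolding TH using r by (simp add: algebra_simps)
  qed
  \<comment> \<open>As \<rho> \<ge> 2, ln (1 + \<rho>) \<le> 2 ln \<rho> and 18 \<le> 27 ln \<rho>;
    thus 18 + 8 ln (1 + \<rho>) is at most (27 + 16) ln \<rho>.\<close>
  also have "\<dots> \<le> (U * sqrt \<rho>) * (43 * ln \<rho>)"
  proof (rule mult_left_mono)
    have "\<rho> * 2 \<le> \<rho> * \<rho>" using r by (intro mult_left_mono) auto
    then have "1 + \<rho> \<le> \<rho>\<^sup>2" unfolding power2_eq_square using r by linarith
    then have "ln (1 + \<rho>) \<le> ln (\<rho>\<^sup>2)" using r by (subst ln_le_cancel_iff) auto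
    moreover have "ln (\<rho>\<^sup>2) = 2 * ln \<rho>" using r by (simp add: ln_realpow)
    moreover have "2 / 3 \<le> ln \<rho>"
      using ln2_ge_two_thirds ln_le_cancel_iff[of 2 \<rho>] r by linarith
    ultimately show "K + 16 \<le> 43 * ln \<rho>" by (simp add: K_def)
  qed (use r in simp)
  finally show ?thesis unfolding UH by (simp add: \<rho>_def mult.assoc mult.left_commute)
qed

text \<open>The quantifier order encodes the agent's knowledge: the policy is fixed from the
  matrices and the source vectors \<open>y u\<close>, before \<theta>, users, decision sets and
  noise law. H \<ge> 2 U keeps the logarithm away from 0, so an absolute constant can absorb
  lower-order terms.\<close>

theorem theorem2:
  shows "\<exists>C>0. \<forall>(n::nat) (a::nat) (b::nat) (U::nat) (H::nat) (A::rmat) (B::rmat).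
    b \<ge> 1 \<and> U \<ge> 1 \<and> H \<ge> 2 * U \<and> full_row_rank A a n \<and> full_row_rank B b n \<longrightarrow>
    (\<forall>y::nat \<Rightarrow> rvec. \<exists>\<pi>::policy.
       (\<forall>h hs u S. finite S \<and> S \<noteq> {} \<longrightarrow> set_pmf (\<pi> h hs u S) \<subseteq> S) \<and>
       (\<forall>(\<theta>::nat \<Rightarrow> rvec) (us::nat \<Rightarrow> nat) (D::nat \<Rightarrow> rvec set) (N::real measure).
          (\<forall>u<U. norm_k n (\<theta> u) \<le> 1 \<and> norm_k b (matvec B n (\<theta> u)) \<le> 1 \<and>
                 (\<forall>i<a. matvec A n (\<theta> u) i = y u i)) \<and>
          (\<forall>h<H. us h < U \<and> finite (D h) \<and> D h \<noteq> {} \<and> (\<forall>x\<in>D h. norm_k b x \<le> 1)) \<and>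
          subgaussian1 N \<longrightarrow>
          regret \<pi> B b n \<theta> us D N H
            \<le> C * (1 - common_info A B a b n) * real b * sqrt (real U * real H)
                * ln (real H / real U)))"
proof (intro exI[of _ 43] conjI allI impI)
  fix n a b U H :: nat and A B :: rmat and y :: "nat \<Rightarrow> rvec"
  assume *: "b \<ge> 1 \<and> U \<ge> 1 \<and> H \<ge> 2 * U \<and> full_row_rank A a n \<and> full_row_rank B b n"
  obtain d \<phi> known where d: "d + subspace_dim (row_space A a n \<inter> row_space B b n) \<le> b"
    and \<phi>: "\<And>x. inner_k d (\<phi> x) (\<phi> x) \<le> inner_k b x x"
    and known: "\<And>x \<theta> y. \<forall>i<a. matvec A n \<theta> i = y i \<Longrightarrow>
       inner_k b x (matvec B n \<theta>) = known y x + inner_k d (\<phi> x) (\<phi> (matvec B n \<theta>))"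
    by (rule reward_decomposition[of A a n B b]) blast
  define off where "off = (\<lambda>u. known (y u))"
  show "\<exists>\<pi>::policy.
       (\<forall>h hs u S. finite S \<and> S \<noteq> {} \<longrightarrow> set_pmf (\<pi> h hs u S) \<subseteq> S) \<and>
       (\<forall>(\<theta>::nat \<Rightarrow> rvec) (us::nat \<Rightarrow> nat) (D::nat \<Rightarrow> rvec set) (N::real measure).
          (\<forall>u<U. norm_k n (\<theta> u) \<le> 1 \<and> norm_k b (matvec B n (\<theta> u)) \<le> 1 \<and>
                 (\<forall>i<a. matvec A n (\<theta> u) i = y u i)) \<and>
          (\<forall>h<H. us h < U \<and> finite (D h) \<and> D h \<noteq> {} \<and> (\<forall>x\<in>D h. norm_k b x \<le> 1)) \<and>
          subgaussian1 N \<longrightarrow>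
          regret \<pi> B b n \<theta> us D N H
            \<le> 43 * (1 - common_info A B a b n) * real b * sqrt (real U * real H)
                * ln (real H / real U))"
  proof (intro exI[of _ "optimistic_policy d \<phi> off"] conjI allI impI)
    fix h hs u and S :: "rvec set"
    assume S: "finite S \<and> S \<noteq> {}"
    then obtain x where "optimistic_policy d \<phi> off h hs u S = return_pmf x" "x \<in> S"
      using optimistic_policy_choice[of S d \<phi> off h hs u] by blast
    then show "set_pmf (optimistic_policy d \<phi> off h hs u S) \<subseteq> S" by simp
  next
    fix \<theta> :: "nat \<Rightarrow> rvec" and us :: "nat \<Rightarrow> nat" and D :: "nat \<Rightarrow> rvec set" and N :: "real measure"
    assume **: "(\<forall>u<U. norm_k n (\<theta> u) \<le> 1 \<and> norm_k b (matvec B n (\<theta> u)) \<le> 1 \<and>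
                 (\<forall>i<a. matvec A n (\<theta> u) i = y u i)) \<and>
          (\<forall>h<H. us h < U \<and> finite (D h) \<and> D h \<noteq> {} \<and> (\<forall>x\<in>D h. norm_k b x \<le> 1)) \<and>
          subgaussian1 N"
    define w where "w = (\<lambda>u. \<phi> (matvec B n (\<theta> u)))"
    have t: "inner_k b (matvec B n (\<theta> u)) (matvec B n (\<theta> u)) \<le> 1"
      "\<And>i. i < a \<Longrightarrow> matvec A n (\<theta> u) i = y u i" if "u < U" for u
      using ** that by (auto simp: norm_k_le_1_iff)
    have D: "us h < U" "finite (D h)" "D h \<noteq> {}" "\<And>x. x \<in> D h \<Longrightarrow> inner_k b x x \<le> 1" if "h < H" for h
      using ** that by (auto simp: norm_k_le_1_iff)
    interpret linear_bandit d b n H U B \<theta> us D N \<phi> off w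
    proof
      show "subgaussian1 N" using ** by blast
      fix h assume h: "h < H"
      show "us h < U" "finite (D h)" "D h \<noteq> {}" using D[OF h] by auto
      fix x assume x: "x \<in> D h"
      show "\<bar>inner_k b x (matvec B n (\<theta> (us h)))\<bar> \<le> 1"
        using D[OF h] t x by (intro abs_inner_k_le_1) auto
      show "inner_k d (\<phi> x) (\<phi> x) \<le> 1" using \<phi>[of x] D(4)[OF h x] by simp
      show "inner_k b x (matvec B n (\<theta> (us h))) = off (us h) x + inner_k d (\<phi> x) (w (us h))"
        unfolding off_def w_def by (rule known) (use t D(1)[OF h] in auto)
    qed
    let ?R = "43 * sqrt (real U * real H) * ln (real H / real U)"
    have "regret (optimistic_policy d \<phi> off) B b n \<theta> us D N H
        \<le> (\<Sum>u<U. regret_potential d (rounds u H) (w u) [])" by (rule regret_le_potential)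
    also have "\<dots> \<le> (\<Sum>u<U. d * (sqrt (rounds u H) * (2 + 8 * ln (1 + real (rounds u H)))))"
    proof (intro sum_mono regret_potential_Nil_le)
      fix u assume "u \<in> {..<U}"
      then show "inner_k d (w u) (w u) \<le> 1"
        using \<phi>[of "matvec B n (\<theta> u)"] t(1)[of u] by (simp add: w_def)
    qed
    also have "\<dots> \<le> d * ?R"
      unfolding sum_distrib_left[symmetric] using * sum_rounds
      by (intro mult_left_mono sum_sqrt_log_le) auto
    also have "\<dots> \<le> ((1 - common_info A B a b n) * b) * ?R"
    proof (rule mult_right_mono)
      have "real d + real (subspace_dim (row_space A a n \<inter> row_space B b n)) \<le> real b"
        using d by (simp flip: of_nat_add)
      then show "real d \<le> (1 - common_info A B a b n) * b"
        using * by (simp add: common_info_def left_diff_distrib)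
      \<comment> \<open>Makes the logarithm nonnegative, so that enlarging \<open>d\<close> to (1 -
        \<kappa>) b enlarges the bound.\<close>
      have "real U \<le> real H" using * by linarith
      then show "0 \<le> ?R" using * by (simp add: ln_ge_zero field_simps)
    qed
    finally show "regret (optimistic_policy d \<phi> off) B b n \<theta> us D N H
            \<le> 43 * (1 - common_info A B a b n) * real b * sqrt (real U * real H)
                * ln (real H / real U)" by (simp add: mult_ac)
  qed
qed simp

end
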